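(* There exist absolute constants $c,C>0$ and $n_0$ such that for all $n\ge n_0$, $\delta\in(0,1/2]$ and $\varepsilon\in(0,1]$ with $\varepsilon\ge c\sqrt{\log n\log(1/\delta)/n}$, there is an $(\varepsilon,\delta)$-LNDP algorithm $\mathcal{A}$ on $n$-node graphs such that for every $p\in[0,1]$, \[ \Pr\Big[|\mathcal{A}(G)-p|\le C\,\frac{\sqrt{\log n}}{n}\cdot\frac{\sqrt{\log(1/\delta)}}{\varepsilon}\Big]\ge\frac23, \] where the probability is over $G\sim G(n,p)$ and the coins of $\mathcal{A}$.
   Context: Graphs are simple and undirected on node set $[n]$; $N_i^G$ is the neighborhood of node $i$. $G(n,p)$ is the Erdős–Rényi distribution (each edge present independently with probability $p$). Two graphs on $[n]$ are node neighbors if they differ only in edges incident to a single node. Random variables $R_1,R_2$ are $(\varepsilon,\delta)$-indistinguishable if for every event $Y$, $\Pr[R_1\in Y]\le e^\varepsilon\Pr[R_2\in Y]+\delta$ and symmetrically. An algorithm $\mathcal{A}$ on $n$-node graphs is (noninteractive) $(\varepsilon,\delta)$-LNDP if there exist a distribution over public random strings $\rho$, local randomizers $\mathcal{R}_{1,\rho},\dots,\mathcal{R}_{n,\rho}$ (with independent internal randomness), and a postprocessing $\mathcal{P}$ with $\mathcal{A}(G)=\mathcal{P}(\mathcal{R}_{1,\rho}(N_1^G),\dots,\mathcal{R}_{n,\rho}(N_n^G))$, such that for every fixed $\rho$ and every node-neighboring $G,G'$ the randomizer output vectors on $G$ and $G'$ are $(\varepsilon,\delta)$-indistinguishable. *)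

theory Defs
  imports "HOL-Probability.Probability"
begin

definition all_edges :: "nat \<Rightarrow> nat set set" where
  "all_edges n = {e. \<exists>i j. i < j \<and> j < n \<and> e = {i, j}}"

definition is_graph :: "nat \<Rightarrow> nat set set \<Rightarrow> bool" where
  "is_graph n G \<longleftrightarrow> G \<subseteq> all_edges n"

definition nbhd :: "nat \<Rightarrow> nat set set \<Rightarrow> nat \<Rightarrow> nat set" where
  "nbhd n G i = {j. j < n \<and> {i, j} \<in> G}"

definition node_neighbors :: "nat \<Rightarrow> nat set set \<Rightarrow> nat set set \<Rightarrow> bool" where
  "node_neighbors n G G' \<longleftrightarrow>
     (\<exists>v < n. \<forall>e. v \<notin> e \<longrightarrow> (e \<in> G \<longleftrightarrow> e \<in> G'))"

definition gnp :: "nat \<Rightarrow> real \<Rightarrow> nat set set pmf" where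
  "gnp n p = map_pmf (\<lambda>f. {e \<in> all_edges n. f e})
               (Pi_pmf (all_edges n) False (\<lambda>_. bernoulli_pmf p))"

definition indist :: "real \<Rightarrow> real \<Rightarrow> 'a pmf \<Rightarrow> 'a pmf \<Rightarrow> bool" where
  "indist \<epsilon> \<delta> R1 R2 \<longleftrightarrow>
     (\<forall>Y. measure_pmf.prob R1 Y \<le> exp \<epsilon> * measure_pmf.prob R2 Y + \<delta> \<and>
          measure_pmf.prob R2 Y \<le> exp \<epsilon> * measure_pmf.prob R1 Y + \<delta>)"

definition rand_outputs ::
  "nat \<Rightarrow> (nat \<Rightarrow> nat set \<Rightarrow> real pmf) \<Rightarrow> nat set set \<Rightarrow> (nat \<Rightarrow> real) pmf" where
  "rand_outputs n R G = Pi_pmf {..<n} 0 (\<lambda>i. R i (nbhd n G i))"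

text \<open>Noninteractive (eps,delta)-local node differential privacy.  Public randomness
  rho is drawn from a (discrete) distribution pub; R rho i is the local randomizer of
  node i; P is the postprocessing.\<close>
definition LNDP :: "nat \<Rightarrow> real \<Rightarrow> real \<Rightarrow> (nat set set \<Rightarrow> real pmf) \<Rightarrow> bool" where
  "LNDP n \<epsilon> \<delta> A \<longleftrightarrow>
     (\<exists>(pub :: nat pmf) (R :: nat \<Rightarrow> nat \<Rightarrow> nat set \<Rightarrow> real pmf) (P :: (nat \<Rightarrow> real) \<Rightarrow> real).
        (\<forall>G. is_graph n G \<longrightarrow>
              A G = bind_pmf pub (\<lambda>\<rho>. map_pmf P (rand_outputs n (R \<rho>) G))) \<and>
        (\<forall>\<rho> G G'. is_graph n G \<and> is_graph n G' \<and> node_neighbors n G G' \<longrightarrow>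
              indist \<epsilon> \<delta> (rand_outputs n (R \<rho>) G) (rand_outputs n (R \<rho>) G')))"

end

theory Submission
  imports Defs
begin

text \<open>
  Subdivide the range of possible degrees into cells of length $L \approx 4\sqrt{n\log n}$, the
  scale on which the degrees of $G(n,p)$ are concentrated. Every node publishes, for each cell
  boundary $kL$, a bit of bias $1/2 + \eta w_k$, where $w_k$ is the tent function of width $L$ around
  $kL$ at its degree and $\eta = \varepsilon/(14\sqrt{\log(1/\delta)})$.

  Privacy: changing one node alters its own biases by $O(\eta)$ in the Euclidean norm and those of
  every other node by $O(\eta/L)$, hence all biases together by $O(\eta)$, and a product of bits hides
  such a change just as Gaussian noise of variance of order $1$ would.

  Accuracy: the corrected column sums estimate the smoothed degree histogram up to
  $O(\sqrt n/\eta)$ per column, and up to $n/16$ in all columns simultaneously: this is where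
  the lower bound on $\varepsilon$ enters. A heavy column therefore locates all degrees within two cells.
  The tents form a partition of unity that reproduces linear functions, so the first moment of the
  few columns around the heavy one recovers the sum of the degrees with error $O(L\sqrt n/\eta)$.
\<close>

section \<open>Tent functions\<close>

definition tent :: "real \<Rightarrow> real" where
  "tent y = max 0 (1 - \<bar>y\<bar>)"

lemma tent_nonneg: "0 \<le> tent y" and tent_le_1: "tent y \<le> 1"
  by (auto simp: tent_def)

lemma tent_eq_0: "1 \<le> \<bar>y\<bar> \<Longrightarrow> tent y = 0"
  by (simp add: tent_def)

lemma tent_pos_imp: "0 < tent y \<Longrightarrow> \<bar>y\<bar> < 1"
  by (auto simp: tent_def max_def split: if_splits)

lemma tent_ge: "1 - \<bar>y\<bar> \<le> tent y"
  by (simp add: tent_def)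

lemma tent_lipschitz: "\<bar>tent x - tent y\<bar> \<le> \<bar>x - y\<bar>"
  unfolding tent_def by linarith

lemma tent_support:
  assumes "0 \<le> x"
  shows "{k. tent (x - real k) \<noteq> 0} \<subseteq> {nat \<lfloor>x\<rfloor>, nat \<lfloor>x\<rfloor> + 1}"
proof
  fix k assume "k \<in> {k. tent (x - real k) \<noteq> 0}"
  then have "\<bar>x - real k\<bar> < 1"
    using tent_eq_0 by force
  then have "int k = \<lfloor>x\<rfloor> \<or> int k = \<lfloor>x\<rfloor> + 1"
    by linarith
  then show "k \<in> {nat \<lfloor>x\<rfloor>, nat \<lfloor>x\<rfloor> + 1}"
    using assms by (auto simp: nat_add_distrib)
qed

text \<open>Only the two grid points enclosing \<open>x\<close> carry a nonzero tent, with weights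
  \<open>1 - frac x\<close> and \<open>frac x\<close>, so the sum is the linear interpolation of
  \<open>f\<close> at \<open>x\<close>. The strict bound \<open>x < real K\<close> keeps the upper
  grid point inside the range of summation.\<close>

lemma tent_sum_eq:
  fixes f :: "nat \<Rightarrow> real"
  assumes "0 \<le> x" "x < real K"
  shows "(\<Sum>k\<le>K. f k * tent (x - real k)) =
    f (nat \<lfloor>x\<rfloor>) * (1 - frac x) + f (nat \<lfloor>x\<rfloor> + 1) * frac x"
proof -
  let ?j = "nat \<lfloor>x\<rfloor>"
  have j: "real ?j = x - frac x" using assms by (simp add: frac_def)
  have "?j + 1 \<le> K" using assms by linarith
  then have "(\<Sum>k\<le>K. f k * tent (x - real k)) = (\<Sum>k\<in>{?j, ?j + 1}. f k * tent (x - real k))"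
    using tent_support[OF assms(1)] by (intro sum.mono_neutral_right) auto
  also have "tent (x - real ?j) = 1 - frac x"
    using frac_lt_1[of x] by (simp add: j tent_def)
  moreover have "tent (x - real (?j + 1)) = frac x"
    using frac_lt_1[of x] frac_ge_0[of x] by (simp add: j tent_def)
  ultimately show ?thesis by simp
qed

lemma tent_sum_1: "0 \<le> x \<Longrightarrow> x < real K \<Longrightarrow> (\<Sum>k\<le>K. tent (x - real k)) = 1"
  using tent_sum_eq[of x K "\<lambda>_. 1"] by simp

text \<open>Linear interpolation reproduces linear functions. This is why the first moment of the
  smoothed histogram loses nothing to the subdivision into cells.\<close>

lemma tent_sum_moment:
  assumes "0 \<le> x" "x < real K"
  shows "(\<Sum>k\<le>K. (real k - c) * tent (x - real k)) = x - c"
proof -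
  have "real (nat \<lfloor>x\<rfloor>) = x - frac x" using assms by (simp add: frac_def)
  then show ?thesis
    using tent_sum_eq[OF assms, of "\<lambda>k. real k - c"] by (simp add: algebra_simps)
qed

text \<open>Serves the rewired node, whose degree may move arbitrarily far: the bound does not
  depend on \<open>x - y\<close>. On [0,1] one has \<open>(a - b)\<^sup>2 \<le> a + b\<close>, and
  each of the two families of tents sums to 1.\<close>

lemma tent_sum_sq_le_2:
  assumes "0 \<le> x" "x < real K" "0 \<le> y" "y < real K"
  shows "(\<Sum>k\<le>K. (tent (x - real k) - tent (y - real k))\<^sup>2) \<le> 2"
proof -
  have *: "(a - b)\<^sup>2 \<le> a + b" if "0 \<le> a" "a \<le> 1" "0 \<le> b" "b \<le> 1" for a b :: real
  proof -
    have "a * a \<le> a * 1" "b * b \<le> b * 1" "0 \<le> a * b"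
      using that by (intro mult_left_mono mult_nonneg_nonneg; simp)+
    then show ?thesis by (simp add: power2_eq_square algebra_simps)
  qed
  have "(\<Sum>k\<le>K. (tent (x - real k) - tent (y - real k))\<^sup>2)
      \<le> (\<Sum>k\<le>K. tent (x - real k) + tent (y - real k))"
    by (intro sum_mono * tent_nonneg tent_le_1)
  also have "\<dots> = 2"
    using assms by (simp add: sum.distrib tent_sum_1)
  finally show ?thesis .
qed

text \<open>Serves the remaining nodes, whose degrees move by at most 1: at most four grid points
  see a nonzero tent, and each tent is 1-Lipschitz.\<close>

lemma tent_sum_sq_lipschitz:
  assumes "0 \<le> x" "0 \<le> y"
  shows "(\<Sum>k\<le>K. (tent (x - real k) - tent (y - real k))\<^sup>2) \<le> 4 * (x - y)\<^sup>2"
proof -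
  let ?S = "{nat \<lfloor>x\<rfloor>, nat \<lfloor>x\<rfloor> + 1, nat \<lfloor>y\<rfloor>, nat \<lfloor>y\<rfloor> + 1}"
  \<comment> \<open>Passing to a list bounds the cardinality without deciding which of the four
    points coincide.\<close>
  have "card ?S \<le> 4"
    using card_length[of "[nat \<lfloor>x\<rfloor>, nat \<lfloor>x\<rfloor> + 1, nat \<lfloor>y\<rfloor>, nat \<lfloor>y\<rfloor> + 1]"] by simp
  have zero: "tent (x - real k) - tent (y - real k) = 0" if "k \<notin> ?S" for k
  proof -
    have "tent (x - real k) = 0" using that tent_support[OF assms(1)] by blast
    moreover have "tent (y - real k) = 0" using that tent_support[OF assms(2)] by blast
    ultimately show ?thesis by simp
  qed
  have "(\<Sum>k\<le>K. (tent (x - real k) - tent (y - real k))\<^sup>2)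
      \<le> (\<Sum>k\<in>{..K} \<union> ?S. (tent (x - real k) - tent (y - real k))\<^sup>2)"
    by (intro sum_mono2) auto
  also have "\<dots> = (\<Sum>k\<in>?S. (tent (x - real k) - tent (y - real k))\<^sup>2)"
    using zero by (intro sum.mono_neutral_right) auto
  also have "\<dots> \<le> (\<Sum>k\<in>?S. (x - y)\<^sup>2)"
  proof (intro sum_mono)
    fix k
    show "(tent (x - real k) - tent (y - real k))\<^sup>2 \<le> (x - y)\<^sup>2"
      using tent_lipschitz[of "x - real k" "y - real k"] by (simp add: abs_le_square_iff)
  qed
  also have "\<dots> = real (card ?S) * (x - y)\<^sup>2" by (simp only: sum_constant)
  also have "\<dots> \<le> 4 * (x - y)\<^sup>2"
    using \<open>card ?S \<le> 4\<close> by (intro mult_right_mono) (simp_all del: card_insert_if)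
  finally show ?thesis .
qed

section \<open>Products of Bernoulli distributions\<close>

text \<open>Hoeffding's lemma for a centred bit, which takes the values \<open>1 - q\<close> and
  \<open>- q\<close> in an interval of length 1. Negative \<open>h\<close> reduces to positive
  \<open>h\<close> by exchanging the two outcomes.\<close>

lemma bernoulli_mgf:
  fixes q h :: real
  assumes "0 \<le> q" "q \<le> 1"
  shows "q * exp (h * (1 - q)) + (1 - q) * exp (- h * q) \<le> exp (h\<^sup>2 / 8)"
proof -
  have main: "q * exp (h * (1 - q)) + (1 - q) * exp (- h * q) \<le> exp (h\<^sup>2 / 8)"
    if "0 \<le> q" "q \<le> 1" "0 \<le> h" for q h :: real
  proof -
    have pos: "0 < 1 + q * (exp h - 1)"
      using that by (simp add: add_pos_nonneg)
    have "q * exp (h * (1 - q)) + (1 - q) * exp (- h * q) = exp (- h * q) * (1 + q * (exp h - 1))"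
      by (simp add: algebra_simps flip: exp_add)
    also have "\<dots> = exp (- h * q + ln (1 + q * (exp h - 1)))"
      using pos by (simp only: exp_add exp_ln)
    also have "\<dots> \<le> exp (h\<^sup>2 / 8)"
      using Hoeffdings_lemma_aux[of h q] that by simp
    finally show ?thesis .
  qed
  show ?thesis
  proof (cases "0 \<le> h")
    case True
    then show ?thesis using main[of q h] assms by simp
  next
    case False
    then show ?thesis using main[of "1 - q" "- h"] assms by (simp add: algebra_simps)
  qed
qed

text \<open>Under \<open>q\<close>, the likelihood ratio minus 1 is the centred bit times
  \<open>(p - q) / (q * (1 - q))\<close>, so Hoeffding's lemma applies. The range of
  \<open>q\<close> gives \<open>q * (1 - q) \<ge> 3/16\<close>; since (16/3)^2 is below 32, the
  exponent \<open>h\<^sup>2 / 8\<close> yields the factor 4.\<close>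

lemma bernoulli_ratio_mgf:
  fixes p q \<alpha> :: real
  assumes "q \<in> {1/4..3/4}" "p \<in> {0..1}"
  shows "measure_pmf.expectation (bernoulli_pmf q)
      (\<lambda>b. exp (\<alpha> * (pmf (bernoulli_pmf p) b / pmf (bernoulli_pmf q) b - 1)))
    \<le> exp (4 * \<alpha>\<^sup>2 * (p - q)\<^sup>2)"
proof -
  define h where "h = \<alpha> * (p - q) / (q * (1 - q))"
  have q: "0 < q" "q < 1" using assms by auto
  have e1: "\<alpha> * (p / q - 1) = h * (1 - q)" and e2: "\<alpha> * ((1 - p) / (1 - q) - 1) = - h * q"
    using q by (auto simp: h_def field_simps)
  have "0 \<le> (q - 1/4) * (3/4 - q)" using assms by (intro mult_nonneg_nonneg) auto
  then have "3/16 \<le> q * (1 - q)" by (simp add: field_simps)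
  then have "(3/16)\<^sup>2 \<le> (q * (1 - q))\<^sup>2" by (intro power_mono) auto
  then have "1 / (q * (1 - q))\<^sup>2 \<le> 32"
    using q by (simp add: divide_simps power2_eq_square)
  then have "(\<alpha> * (p - q))\<^sup>2 * (1 / (q * (1 - q))\<^sup>2) \<le> (\<alpha> * (p - q))\<^sup>2 * 32"
    by (intro mult_left_mono) auto
  then have h2: "h\<^sup>2 / 8 \<le> 4 * \<alpha>\<^sup>2 * (p - q)\<^sup>2"
    by (simp add: h_def power_divide power_mult_distrib)
  have "measure_pmf.expectation (bernoulli_pmf q)
      (\<lambda>b. exp (\<alpha> * (pmf (bernoulli_pmf p) b / pmf (bernoulli_pmf q) b - 1)))
     = q * exp (h * (1 - q)) + (1 - q) * exp (- h * q)"
    using q assms by (simp add: e1 e2)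
  also have "\<dots> \<le> exp (h\<^sup>2 / 8)" using q by (intro bernoulli_mgf) auto
  also have "\<dots> \<le> exp (4 * \<alpha>\<^sup>2 * (p - q)\<^sup>2)" using h2 by simp
  finally show ?thesis .
qed

section \<open>Indistinguishability under post-processing and for products of bits\<close>

lemma indist_map_pmf:
  "indist \<epsilon> \<delta> M N \<Longrightarrow> indist \<epsilon> \<delta> (map_pmf f M) (map_pmf f N)"
  by (simp add: indist_def)

lemma half_le_ln_inverse:
  fixes \<delta> :: real
  assumes "0 < \<delta>" "\<delta> \<le> 1/2"
  shows "1/2 \<le> ln (1/\<delta>)"
proof -
  have "exp (1/2 :: real) \<le> 1 + 1/2 + (1/2)\<^sup>2" by (rule exp_bound) auto
  also have "\<dots> \<le> 1/\<delta>" using assms by (simp add: field_simps power2_eq_square)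
  finally show ?thesis using assms by (subst ln_ge_iff) auto
qed

text \<open>A Chernoff argument for the privacy loss. The density ratio of the two products is at
  most \<open>exp (T f)\<close>, where \<open>T\<close> is a sum of independent centred terms under
  the second product. Outcomes with \<open>T f \<le> \<epsilon>\<close> are covered by the factor
  \<open>exp \<epsilon>\<close>; the others contribute at most \<open>\<delta>\<close> by the
  exponential moment of order \<open>\<alpha>\<close>.\<close>

lemma Pi_bernoulli_prob_le:
  fixes p q :: "'a \<Rightarrow> real"
  assumes A: "finite A"
    and p: "\<And>a. a \<in> A \<Longrightarrow> p a \<in> {1/4..3/4}" and q: "\<And>a. a \<in> A \<Longrightarrow> q a \<in> {1/4..3/4}"
    and \<delta>: "0 < \<delta>" "\<delta> \<le> 1/2" and \<epsilon>: "0 < \<epsilon>" "\<epsilon> \<le> 1"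
    and S: "64 * ln (1/\<delta>) * (\<Sum>a\<in>A. (p a - q a)\<^sup>2) \<le> \<epsilon>\<^sup>2"
  shows "measure_pmf.prob (Pi_pmf A False (\<lambda>a. bernoulli_pmf (p a))) Y
    \<le> exp \<epsilon> * measure_pmf.prob (Pi_pmf A False (\<lambda>a. bernoulli_pmf (q a))) Y + \<delta>"
proof -
  define P where "P = Pi_pmf A False (\<lambda>a. bernoulli_pmf (p a))"
  define Q where "Q = Pi_pmf A False (\<lambda>a. bernoulli_pmf (q a))"
  \<comment> \<open>Both supports lie in this finite set, so probabilities and expectations become
    finite sums.\<close>
  define F where "F = PiE_dflt A False (\<lambda>_. UNIV :: bool set)"
  define r where "r = (\<lambda>a b. pmf (bernoulli_pmf (p a)) b / pmf (bernoulli_pmf (q a)) b)"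
  define T where "T = (\<lambda>f. \<Sum>a\<in>A. r a (f a) - 1)"
  define l where "l = ln (1/\<delta>)"
  \<comment> \<open>Chosen so that \<open>(\<alpha> - 1) * \<epsilon> = 2 * l\<close>: the moment
    costs at most \<open>exp l\<close>, and \<open>exp l * exp (- 2 * l) = \<delta>\<close>.\<close>
  define \<alpha> where "\<alpha> = 1 + 2 * l / \<epsilon>"
  have finF: "finite F" unfolding F_def using A by (intro finite_PiE_dflt) auto
  have sub: "set_pmf P \<subseteq> F" "set_pmf Q \<subseteq> F"
    using A by (auto simp: P_def Q_def F_def set_Pi_pmf PiE_dflt_def)
  have exp_l: "exp l = 1 / \<delta>" using \<delta> by (simp add: l_def)
  have l: "1/2 \<le> l" unfolding l_def using \<delta> by (rule half_le_ln_inverse)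
  have \<alpha>1: "1 \<le> \<alpha>" using l \<epsilon> by (simp add: \<alpha>_def)
  have "\<epsilon> \<le> 2 * l" using l \<epsilon> by linarith
  then have \<alpha>4: "\<alpha> \<le> 4 * l / \<epsilon>" using \<epsilon> by (simp add: \<alpha>_def field_simps)
  \<comment> \<open>The constant 64 of the hypothesis is 4 * 4^2, from the factor 4 of
    \<open>bernoulli_ratio_mgf\<close> and from
    \<open>\<alpha> \<le> 4 * l / \<epsilon>\<close>.\<close>
  have "4 * \<alpha>\<^sup>2 * (\<Sum>a\<in>A. (p a - q a)\<^sup>2) \<le> 4 * (4 * l / \<epsilon>)\<^sup>2 * (\<Sum>a\<in>A. (p a - q a)\<^sup>2)"
    using \<alpha>1 \<alpha>4 by (intro mult_right_mono mult_left_mono power_mono sum_nonneg) auto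
  also have "\<dots> = l / \<epsilon>\<^sup>2 * (64 * l * (\<Sum>a\<in>A. (p a - q a)\<^sup>2))"
    by (simp add: power2_eq_square)
  also have "\<dots> \<le> l / \<epsilon>\<^sup>2 * \<epsilon>\<^sup>2"
    using l S unfolding l_def by (intro mult_left_mono) auto
  finally have mgf_exponent: "4 * \<alpha>\<^sup>2 * (\<Sum>a\<in>A. (p a - q a)\<^sup>2) \<le> l" using \<epsilon> by simp

  have pointwise: "pmf P f \<le> exp \<epsilon> * pmf Q f + exp (\<alpha> * T f) * pmf Q f * exp (- (\<alpha> - 1) * \<epsilon>)"
    if "f \<in> F" for f
  proof -
    have out: "f a = False" if "a \<notin> A" for a
      using that \<open>f \<in> F\<close> by (auto simp: F_def PiE_dflt_def)
    have "pmf P f = (\<Prod>a\<in>A. r a (f a) * pmf (bernoulli_pmf (q a)) (f a))"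
      unfolding P_def using out A
    proof (subst pmf_Pi', simp_all, intro prod.cong refl)
      fix a assume "a \<in> A"
      then have "pmf (bernoulli_pmf (q a)) (f a) > 0"
        using q[of a] by (cases "f a") auto
      then show "pmf (bernoulli_pmf (p a)) (f a) = r a (f a) * pmf (bernoulli_pmf (q a)) (f a)"
        by (simp add: r_def)
    qed
    also have "\<dots> = (\<Prod>a\<in>A. r a (f a)) * pmf Q f"
      unfolding Q_def using out A by (subst pmf_Pi') (auto simp: prod.distrib)
    also have "\<dots> \<le> exp (T f) * pmf Q f"
    proof (intro mult_right_mono)
      \<comment> \<open>Each factor satisfies \<open>r \<le> exp (r - 1)\<close>. This replaces the
        log-likelihood by a linear expression whose mean under \<open>Q\<close> is exactly
        0.\<close>
      have "(\<Prod>a\<in>A. r a (f a)) \<le> (\<Prod>a\<in>A. exp (r a (f a) - 1))"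
      proof (intro prod_mono conjI)
        fix a
        show "0 \<le> r a (f a)" by (simp add: r_def)
        show "r a (f a) \<le> exp (r a (f a) - 1)"
          using exp_ge_add_one_self[of "r a (f a) - 1"] by simp
      qed
      then show "(\<Prod>a\<in>A. r a (f a)) \<le> exp (T f)"
        using A by (simp add: T_def exp_sum)
    qed auto
    (* Where T f exceeds epsilon, the surplus pays for the exponent alpha. *)
    also have "\<dots> \<le> (exp \<epsilon> + exp (\<alpha> * T f - (\<alpha> - 1) * \<epsilon>)) * pmf Q f"
    proof (intro mult_right_mono)
      show "exp (T f) \<le> exp \<epsilon> + exp (\<alpha> * T f - (\<alpha> - 1) * \<epsilon>)"
      proof (cases "T f \<le> \<epsilon>")
        case True
        then show ?thesis by (simp add: add_increasing2)
      next
        case False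
        then have "0 \<le> (\<alpha> - 1) * (T f - \<epsilon>)" using \<alpha>1 by simp
        then have "T f \<le> \<alpha> * T f - (\<alpha> - 1) * \<epsilon>" by (simp add: algebra_simps)
        then show ?thesis by (simp add: add_increasing)
      qed
    qed auto
    finally show ?thesis by (simp add: algebra_simps flip: exp_add)
  qed

  \<comment> \<open>The coordinates are independent under \<open>Q\<close>, so the exponential
    moment splits into one factor per bit.\<close>
  have "(\<Sum>f\<in>F. exp (\<alpha> * T f) * pmf Q f) = measure_pmf.expectation Q (\<lambda>f. exp (\<alpha> * T f))"
    using finF sub(2) by (subst integral_measure_pmf_real[of F]) auto
  also have "\<dots> = measure_pmf.expectation Q (\<lambda>f. \<Prod>a\<in>A. exp (\<alpha> * (r a (f a) - 1)))"
    using A by (simp add: T_def exp_sum sum_distrib_left)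
  also have "\<dots> = (\<Prod>a\<in>A. measure_pmf.expectation (bernoulli_pmf (q a))
      (\<lambda>b. exp (\<alpha> * (r a b - 1))))"
    unfolding Q_def using A
    by (intro expectation_prod_Pi_pmf integrable_measure_pmf_finite) auto
  also have "\<dots> \<le> (\<Prod>a\<in>A. exp (4 * \<alpha>\<^sup>2 * (p a - q a)\<^sup>2))"
  proof (intro prod_mono conjI)
    fix a assume "a \<in> A"
    then have "p a \<in> {0..1}" using p[of a] by auto
    then show "measure_pmf.expectation (bernoulli_pmf (q a)) (\<lambda>b. exp (\<alpha> * (r a b - 1)))
        \<le> exp (4 * \<alpha>\<^sup>2 * (p a - q a)\<^sup>2)"
      unfolding r_def using q[OF \<open>a \<in> A\<close>] by (intro bernoulli_ratio_mgf) auto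
  qed (intro integral_nonneg_AE, auto)
  also have "\<dots> = exp (4 * \<alpha>\<^sup>2 * (\<Sum>a\<in>A. (p a - q a)\<^sup>2))"
    using A by (simp add: exp_sum sum_distrib_left)
  also have "\<dots> \<le> exp l" using mgf_exponent by simp
  finally have mgf: "(\<Sum>f\<in>F. exp (\<alpha> * T f) * pmf Q f) \<le> exp l" .

  have prob_sum: "measure_pmf.prob M Y = (\<Sum>f\<in>Y \<inter> F. pmf M f)" if "set_pmf M \<subseteq> F" for M
  proof -
    have "measure_pmf.prob M Y = measure_pmf.prob M (Y \<inter> F)"
      using that by (intro measure_prob_cong_0) (auto simp: pmf_eq_0_set_pmf)
    also have "\<dots> = (\<Sum>f\<in>Y \<inter> F. pmf M f)"
      using finF by (intro measure_measure_pmf_finite) auto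
    finally show ?thesis .
  qed
  have "measure_pmf.prob P Y \<le> (\<Sum>f\<in>Y \<inter> F. exp \<epsilon> * pmf Q f
      + exp (\<alpha> * T f) * pmf Q f * exp (- (\<alpha> - 1) * \<epsilon>))"
    unfolding prob_sum[OF sub(1)] by (intro sum_mono pointwise) auto
  also have "\<dots> = exp \<epsilon> * measure_pmf.prob Q Y
      + (\<Sum>f\<in>Y \<inter> F. exp (\<alpha> * T f) * pmf Q f) * exp (- (\<alpha> - 1) * \<epsilon>)"
    by (simp only: sum.distrib prob_sum[OF sub(2)] sum_distrib_left sum_distrib_right)
  also have "(\<Sum>f\<in>Y \<inter> F. exp (\<alpha> * T f) * pmf Q f) \<le> (\<Sum>f\<in>F. exp (\<alpha> * T f) * pmf Q f)"
    using finF by (intro sum_mono2) auto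
  also note mgf
  also have "exp l * exp (- (\<alpha> - 1) * \<epsilon>) = exp (- l)"
    using \<epsilon> by (simp add: \<alpha>_def flip: exp_add)
  also have "\<dots> = \<delta>" using exp_l \<delta> by (simp add: exp_minus)
  finally show ?thesis by (simp add: P_def Q_def)
qed

lemma indist_Pi_bernoulli:
  fixes p q :: "'a \<Rightarrow> real"
  assumes "finite A"
    and "\<And>a. a \<in> A \<Longrightarrow> p a \<in> {1/4..3/4}" "\<And>a. a \<in> A \<Longrightarrow> q a \<in> {1/4..3/4}"
    and "0 < \<delta>" "\<delta> \<le> 1/2" "0 < \<epsilon>" "\<epsilon> \<le> 1"
    and "64 * ln (1/\<delta>) * (\<Sum>a\<in>A. (p a - q a)\<^sup>2) \<le> \<epsilon>\<^sup>2"
  shows "indist \<epsilon> \<delta> (Pi_pmf A False (\<lambda>a. bernoulli_pmf (p a)))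
    (Pi_pmf A False (\<lambda>a. bernoulli_pmf (q a)))"
  unfolding indist_def using assms
  by (intro allI conjI Pi_bernoulli_prob_le) (auto simp: power2_commute)

text \<open>Merges the bit vectors of all nodes into one product over pairs, to which the bounds for
  a single product apply. Both sides have the same density: as \<open>curry\<close> is injective,
  each is the double product of the one-bit densities, and 0 where a coordinate off
  \<open>A \<times> B\<close> differs from \<open>d\<close>.\<close>

lemma Pi_pmf_Times:
  assumes "finite A" "finite B"
  shows "Pi_pmf A (\<lambda>_. d) (\<lambda>i. Pi_pmf B d (p i)) = map_pmf curry (Pi_pmf (A \<times> B) d (\<lambda>(i, k). p i k))"
proof (rule pmf_eqI)
  fix g :: "'a \<Rightarrow> 'b \<Rightarrow> 'c"
  have "inj (curry :: ('a \<times> 'b \<Rightarrow> 'c) \<Rightarrow> _)"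
    by (rule injI) (metis case_prod_curry)
  then have R: "pmf (map_pmf curry (Pi_pmf (A \<times> B) d (\<lambda>(i, k). p i k))) g =
      pmf (Pi_pmf (A \<times> B) d (\<lambda>(i, k). p i k)) (case_prod g)"
    using pmf_map_inj'[of curry _ "case_prod g"] by simp
  show "pmf (Pi_pmf A (\<lambda>_. d) (\<lambda>i. Pi_pmf B d (p i))) g =
      pmf (map_pmf curry (Pi_pmf (A \<times> B) d (\<lambda>(i, k). p i k))) g"
  proof (cases "\<forall>i k. (i, k) \<notin> A \<times> B \<longrightarrow> g i k = d")
    case True
    then have "pmf (Pi_pmf A (\<lambda>_. d) (\<lambda>i. Pi_pmf B d (p i))) g
        = (\<Prod>i\<in>A. \<Prod>k\<in>B. pmf (p i k) (g i k))"
      using assms by (subst pmf_Pi') (auto intro!: prod.cong pmf_Pi')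
    also have "\<dots> = (\<Prod>(i, k)\<in>A \<times> B. pmf (p i k) (g i k))"
      by (simp add: prod.cartesian_product)
    also have "\<dots> = pmf (Pi_pmf (A \<times> B) d (\<lambda>(i, k). p i k)) (case_prod g)"
    proof -
      have "case_prod g x = d" if "x \<notin> A \<times> B" for x
        using True that by (cases x) auto
      then show ?thesis
        using assms by (subst pmf_Pi'[of "A \<times> B"]) (simp_all add: case_prod_unfold)
    qed
    finally show ?thesis unfolding R .
  next
    case False
    then obtain i k where ik: "(i, k) \<notin> A \<times> B" "g i k \<noteq> d" by blast
    have "pmf (Pi_pmf A (\<lambda>_. d) (\<lambda>i. Pi_pmf B d (p i))) g = 0"
    proof (cases "i \<in> A")
      case True
      then have "pmf (Pi_pmf B d (p i)) (g i) = 0"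
        using ik assms by (intro pmf_Pi_outside) auto
      then have "(\<Prod>i\<in>A. pmf (Pi_pmf B d (p i)) (g i)) = 0"
        using True assms by auto
      then show ?thesis using assms by (simp add: pmf_Pi)
    next
      case False
      then show ?thesis using ik assms by (intro pmf_Pi_outside) auto
    qed
    moreover have "pmf (Pi_pmf (A \<times> B) d (\<lambda>(i, k). p i k)) (case_prod g) = 0"
      using ik assms by (intro pmf_Pi_outside) auto
    ultimately show ?thesis unfolding R by simp
  qed
qed

text \<open>The sum runs over a subset \<open>B\<close> of the coordinates because it is applied to
  the edges at one node and to the bits of one column.\<close>

lemma Pi_bernoulli_Hoeffding:
  fixes q :: "'a \<Rightarrow> real"
  assumes "finite A" "B \<subseteq> A" and q: "\<And>a. a \<in> A \<Longrightarrow> q a \<in> {0..1}" and "0 \<le> t"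
  shows "measure_pmf.prob (Pi_pmf A False (\<lambda>a. bernoulli_pmf (q a)))
      {f. t \<le> \<bar>\<Sum>a\<in>B. of_bool (f a) - q a\<bar>} \<le> 2 * exp (- 2 * t\<^sup>2 / real (card B))"
proof (cases "B = {}")
  \<comment> \<open>Division by \<open>card B = 0\<close> gives 0, so the claimed bound is
    2.\<close>
  case True
  then show ?thesis by (auto intro: order.trans[OF measure_pmf.prob_le_1])
next
  case False
  define M where "M = Pi_pmf A False (\<lambda>a. bernoulli_pmf (q a))"
  have finB: "finite B" using assms finite_subset by blast
  interpret indep_interval_bounded_random_variables "measure_pmf M" B
    "\<lambda>a f. of_bool (f a)" "\<lambda>_. 0" "\<lambda>_. 1"
  proof unfold_locales
    have "prob_space.indep_vars (measure_pmf M) (\<lambda>_. borel) (\<lambda>a f. of_bool (f a) :: real) A"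
      unfolding M_def using assms(1)
      by (intro prob_space.indep_vars_compose2[OF _ indep_vars_Pi_pmf])
         (auto simp: measure_pmf.prob_space_axioms)
    then show "prob_space.indep_vars (measure_pmf M) (\<lambda>_. borel) (\<lambda>a f. of_bool (f a) :: real) B"
      using assms(2) prob_space.indep_vars_subset[OF measure_pmf.prob_space_axioms] by blast
  qed (use finB in auto)
  have E: "measure_pmf.expectation M (\<lambda>f. of_bool (f a)) = q a" if "a \<in> B" for a
  proof -
    have a: "a \<in> A" using that assms by auto
    have "measure_pmf.expectation M (\<lambda>f. of_bool (f a))
        = measure_pmf.expectation (map_pmf (\<lambda>f. f a) M) (\<lambda>b. of_bool b :: real)"
      by simp
    also have "map_pmf (\<lambda>f. f a) M = bernoulli_pmf (q a)"
      unfolding M_def using assms(1) a by (subst Pi_pmf_component) auto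
    finally show ?thesis using q[OF a] by simp
  qed
  interpret Hoeffding_ineq "measure_pmf M" B "\<lambda>a f. of_bool (f a)" "\<lambda>_. 0" "\<lambda>_. 1"
    "\<Sum>a\<in>B. q a"
    by unfold_locales (simp add: E)
  have "0 < card B" using False finB by auto
  then show ?thesis
    using Hoeffding_ineq_abs_ge[OF assms(4)] by (simp add: M_def sum_subtractf)
qed

section \<open>Two-stage experiments and union bounds\<close>

lemma prob_bind_pmf_ge:
  assumes "\<And>x. x \<in> set_pmf M \<Longrightarrow> x \<in> X \<Longrightarrow> b \<le> measure_pmf.prob (f x) S"
    and "a \<le> measure_pmf.prob M X" "0 \<le> b"
  shows "a * b \<le> measure_pmf.prob (bind_pmf M f) S"
proof -
  have "a * b \<le> measure_pmf.prob M X * b" using assms by (intro mult_right_mono) auto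
  also have "\<dots> = measure_pmf.expectation M (\<lambda>x. indicator X x * b)" by simp
  also have "\<dots> \<le> measure_pmf.expectation M (\<lambda>x. measure_pmf.prob (f x) S)"
    using assms
    by (intro integral_mono_AE measure_pmf.integrable_const_bound[where B = 1]
        measure_pmf.integrable_const_bound[where B = b] AE_pmfI)
       (auto simp: indicator_def)
  also have "\<dots> = measure_pmf.prob (bind_pmf M f) S"
    by (simp add: measure_pmf_bind measure_pmf.measure_bind[where N = "count_space UNIV"]
        measure_pmf_in_subprob_algebra)
  finally show ?thesis .
qed

lemma prob_Ball_ge:
  assumes "finite I" "\<And>i. i \<in> I \<Longrightarrow> measure_pmf.prob M {x. \<not> P i x} \<le> b i"
  shows "1 - (\<Sum>i\<in>I. b i) \<le> measure_pmf.prob M {x. \<forall>i\<in>I. P i x}"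
proof -
  have "1 - measure_pmf.prob M {x. \<forall>i\<in>I. P i x} = measure_pmf.prob M (- {x. \<forall>i\<in>I. P i x})"
    using measure_pmf.prob_compl[of "{x. \<forall>i\<in>I. P i x}" M] by (simp add: Compl_eq_Diff_UNIV)
  also have "- {x. \<forall>i\<in>I. P i x} = (\<Union>i\<in>I. {x. \<not> P i x})" by auto
  also have "measure_pmf.prob M \<dots> \<le> (\<Sum>i\<in>I. measure_pmf.prob M {x. \<not> P i x})"
    using assms(1) by (intro measure_pmf.finite_measure_subadditive_finite) auto
  also have "\<dots> \<le> (\<Sum>i\<in>I. b i)" using assms(2) by (rule sum_mono)
  finally show ?thesis by simp
qed

lemma prob_conj_ge:
  assumes "1 - a \<le> measure_pmf.prob M {x. P x}" "1 - b \<le> measure_pmf.prob M {x. Q x}"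
  shows "1 - (a + b) \<le> measure_pmf.prob M {x. P x \<and> Q x}"
proof -
  have compl: "measure_pmf.prob M (- X) = 1 - measure_pmf.prob M X" for X
    using measure_pmf.prob_compl[of X M] by (simp add: Compl_eq_Diff_UNIV)
  have "measure_pmf.prob M (- {x. P x} \<union> - {x. Q x})
      \<le> measure_pmf.prob M (- {x. P x}) + measure_pmf.prob M (- {x. Q x})"
    by (rule measure_Un_le) auto
  moreover have "- {x. P x} \<union> - {x. Q x} = - {x. P x \<and> Q x}" by auto
  ultimately show ?thesis using assms by (simp add: compl)
qed

section \<open>Degrees in random graphs\<close>

lemma all_edges_eq: "all_edges n = {e. e \<subseteq> {..<n} \<and> card e = 2}"
proof (intro equalityI subsetI)
  fix e assume "e \<in> {e. e \<subseteq> {..<n} \<and> card e = 2}"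
  then obtain x y where "e = {x, y}" "x \<noteq> y" "x < n" "y < n"
    by (auto simp: card_2_iff)
  then show "e \<in> all_edges n"
    unfolding all_edges_def by (auto simp: neq_iff insert_commute)
qed (auto simp: all_edges_def)

lemma finite_all_edges: "finite (all_edges n)"
  by (rule finite_subset[of _ "Pow {..<n}"]) (auto simp: all_edges_eq)

lemma card_all_edges: "card (all_edges n) = n choose 2"
  by (simp add: all_edges_eq n_subsets)

lemma is_graph_edge: "is_graph n G \<Longrightarrow> e \<in> G \<Longrightarrow> e \<subseteq> {..<n} \<and> card e = 2"
  by (auto simp: is_graph_def all_edges_eq)

lemma finite_nbhd: "finite (nbhd n G i)"
  by (simp add: nbhd_def)

lemma nbhd_subset:
  assumes "is_graph n G"
  shows "nbhd n G i \<subseteq> {..<n} - {i}"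
  using is_graph_edge[OF assms] by (fastforce simp: nbhd_def)

lemma card_nbhd_less: "is_graph n G \<Longrightarrow> i < n \<Longrightarrow> card (nbhd n G i) < n"
  using card_mono[OF _ nbhd_subset[of n G i]] by simp

text \<open>Expresses a degree as a count of edges, hence under \<open>gnp\<close> as a sum of
  independent indicators.\<close>

lemma card_nbhd_conv_incident:
  assumes "is_graph n G"
  shows "card (nbhd n G i) = card {e \<in> G. i \<in> e}"
proof -
  have "bij_betw (\<lambda>j. {i, j}) (nbhd n G i) {e \<in> G. i \<in> e}"
    unfolding bij_betw_def
  proof (intro conjI equalityI subsetI)
    show "inj_on (\<lambda>j. {i, j}) (nbhd n G i)"
      by (auto simp: inj_on_def doubleton_eq_iff)
    fix e assume e: "e \<in> {e \<in> G. i \<in> e}"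
    then obtain j where "e = {i, j}"
      using is_graph_edge[OF assms] by (force simp: card_2_iff)
    then show "e \<in> (\<lambda>j. {i, j}) ` nbhd n G i"
      using e is_graph_edge[OF assms] by (fastforce simp: nbhd_def)
  qed (auto simp: nbhd_def)
  then show ?thesis by (rule bij_betw_same_card)
qed

lemma card_incident_all_edges:
  assumes "i < n"
  shows "card {e \<in> all_edges n. i \<in> e} = n - 1"
proof -
  have "nbhd n (all_edges n) i = {..<n} - {i}"
    using assms by (auto simp: nbhd_def all_edges_eq card_insert_if)
  then show ?thesis
    using assms card_nbhd_conv_incident[of n "all_edges n" i] by (simp add: is_graph_def)
qed

text \<open>The handshake lemma, by double counting the incidences of nodes and edges.\<close>

lemma sum_degrees:
  assumes "is_graph n G"
  shows "(\<Sum>i<n. card (nbhd n G i)) = 2 * card G"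
proof -
  have fin: "finite G"
    using assms finite_all_edges finite_subset by (auto simp: is_graph_def)
  have "(\<Sum>i<n. card (nbhd n G i)) = (\<Sum>i<n. \<Sum>e\<in>G. of_bool (i \<in> e))"
    using assms fin by (simp add: card_nbhd_conv_incident sum_of_bool_eq Int_def)
  also have "\<dots> = (\<Sum>e\<in>G. \<Sum>i<n. of_bool (i \<in> e))" by (rule sum.swap)
  also have "\<dots> = (\<Sum>e\<in>G. 2)"
  proof (intro sum.cong refl)
    fix e assume "e \<in> G"
    then have "{..<n} \<inter> e = e" "card e = 2" using is_graph_edge[OF assms] by auto
    then show "(\<Sum>i<n. of_bool (i \<in> e)) = (2::nat)" by (simp add: sum_of_bool_eq)
  qed
  finally show ?thesis by simp
qed

text \<open>For \<open>i \<noteq> v\<close>, the only edge at \<open>i\<close> that may differ is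
  the one joining \<open>i\<close> to \<open>v\<close>.\<close>

lemma node_neighbors_degrees:
  assumes "node_neighbors n G G'"
  obtains v where "v < n"
    "\<And>i. i \<noteq> v \<Longrightarrow> \<bar>real (card (nbhd n G i)) - real (card (nbhd n G' i))\<bar> \<le> 1"
proof -
  obtain v where v: "v < n" "\<And>e. v \<notin> e \<Longrightarrow> e \<in> G \<longleftrightarrow> e \<in> G'"
    using assms by (auto simp: node_neighbors_def)
  show ?thesis
  proof
    fix i assume "i \<noteq> v"
    then have "nbhd n G i - {v} = nbhd n G' i - {v}"
      using v(2) by (auto simp: nbhd_def)
    moreover have "card (nbhd n H i - {v}) \<le> card (nbhd n H i)"
      "card (nbhd n H i) \<le> card (nbhd n H i - {v}) + 1" for H
      by (auto simp: card_Diff_singleton_if finite_nbhd)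
    ultimately show "\<bar>real (card (nbhd n G i)) - real (card (nbhd n G' i))\<bar> \<le> 1"
      by (smt (verit) of_nat_1 of_nat_add of_nat_mono)
  qed (fact v(1))
qed

lemma is_graph_gnp: "G \<in> set_pmf (gnp n p) \<Longrightarrow> is_graph n G"
  by (auto simp: gnp_def is_graph_def)

lemma gnp_edges_Hoeffding:
  assumes "B \<subseteq> all_edges n" "0 \<le> p" "p \<le> 1" "0 \<le> t"
  shows "measure_pmf.prob (gnp n p) {G. t \<le> \<bar>real (card (G \<inter> B)) - real (card B) * p\<bar>}
    \<le> 2 * exp (- 2 * t\<^sup>2 / real (card B))"
proof -
  have B: "finite B" using assms(1) finite_all_edges finite_subset by blast
  have "real (card ({e \<in> all_edges n. f e} \<inter> B)) - real (card B) * p = (\<Sum>e\<in>B. of_bool (f e) - p)" for f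
  proof -
    have "{e \<in> all_edges n. f e} \<inter> B = B \<inter> {e. f e}" using assms(1) by auto
    then show ?thesis using B by (simp add: sum_subtractf sum_of_bool_eq)
  qed
  then show ?thesis
    using Pi_bernoulli_Hoeffding[OF finite_all_edges assms(1), of "\<lambda>_. p" t] assms
    by (simp add: gnp_def vimage_def)
qed

lemma prob_gnp_cong:
  assumes "\<And>G. is_graph n G \<Longrightarrow> Q G \<longleftrightarrow> R G"
  shows "measure_pmf.prob (gnp n p) {G. Q G} = measure_pmf.prob (gnp n p) {G. R G}"
  using assms is_graph_gnp[of _ n p] by (intro measure_pmf.finite_measure_eq_AE AE_pmfI) auto

text \<open>Two scales: each degree deviates by at most \<open>sqrt (n * ln n)\<close>, failing with
  probability at most 2/n^2, which survives a union bound over the nodes. The sum of the degrees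
  deviates by only \<open>6 * n\<close>, because it is twice a sum of independent edge
  indicators.\<close>

lemma gnp_degrees_concentrated:
  assumes "100 \<le> n" "0 \<le> p" "p \<le> 1"
  shows "9/10 \<le> measure_pmf.prob (gnp n p)
    {G. (\<forall>i\<in>{..<n}. \<bar>real (card (nbhd n G i)) - (real n - 1) * p\<bar> \<le> sqrt (n * ln n)) \<and>
        \<bar>(\<Sum>i<n. real (card (nbhd n G i))) - n * (real n - 1) * p\<bar> \<le> 6 * real n}"
proof -
  have ln_n: "0 < ln (real n)" using assms by simp
  have deg: "measure_pmf.prob (gnp n p)
      {G. \<not> \<bar>real (card (nbhd n G i)) - (real n - 1) * p\<bar> \<le> sqrt (n * ln n)} \<le> 2 / (real n)\<^sup>2"
    if "i \<in> {..<n}" for i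
  proof -
    let ?B = "{e \<in> all_edges n. i \<in> e}"
    have B: "real (card ?B) = real n - 1"
      using that assms by (simp add: card_incident_all_edges)
    have "measure_pmf.prob (gnp n p)
      {G. \<not> \<bar>real (card (nbhd n G i)) - (real n - 1) * p\<bar> \<le> sqrt (n * ln n)}
      = measure_pmf.prob (gnp n p)
      {G. \<not> \<bar>real (card (G \<inter> ?B)) - real (card ?B) * p\<bar> \<le> sqrt (n * ln n)}"
    proof (rule prob_gnp_cong)
      fix G assume G: "is_graph n G"
      then have "{e \<in> G. i \<in> e} = G \<inter> ?B" by (auto simp: is_graph_def)
      then show "(\<not> \<bar>real (card (nbhd n G i)) - (real n - 1) * p\<bar> \<le> sqrt (n * ln n)) \<longleftrightarrow>
          (\<not> \<bar>real (card (G \<inter> ?B)) - real (card ?B) * p\<bar> \<le> sqrt (n * ln n))"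
        unfolding B using card_nbhd_conv_incident[OF G, of i] by simp
    qed
    also have "\<dots> \<le> measure_pmf.prob (gnp n p)
      {G. sqrt (n * ln n) \<le> \<bar>real (card (G \<inter> ?B)) - real (card ?B) * p\<bar>}"
      by (intro measure_pmf.finite_measure_mono) auto
    also have "\<dots> \<le> 2 * exp (- 2 * (sqrt (n * ln n))\<^sup>2 / real (card ?B))"
      using assms ln_n by (intro gnp_edges_Hoeffding) auto
    also have "\<dots> \<le> 2 * exp (- 2 * ln n)"
      unfolding B using assms ln_n by (simp add: field_simps)
    also have "exp (- 2 * ln n) = 1 / (real n)\<^sup>2"
      using assms by (simp add: exp_minus exp_double divide_inverse)
    finally show ?thesis by simp
  qed
  have "1 - (\<Sum>i<n. 2 / (real n)\<^sup>2) \<le> measure_pmf.prob (gnp n p)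
    {G. \<forall>i\<in>{..<n}. \<bar>real (card (nbhd n G i)) - (real n - 1) * p\<bar> \<le> sqrt (n * ln n)}"
    by (rule prob_Ball_ge[OF _ deg]) auto
  moreover have "(\<Sum>i<n. 2 / (real n)\<^sup>2) = 2 / n"
    using assms by (simp add: power2_eq_square)
  moreover have "2 / real n \<le> 2 / 100" using assms by (intro divide_left_mono) auto
  ultimately have all: "1 - 2 / 100 \<le> measure_pmf.prob (gnp n p)
    {G. \<forall>i\<in>{..<n}. \<bar>real (card (nbhd n G i)) - (real n - 1) * p\<bar> \<le> sqrt (n * ln n)}"
    by linarith
  have N: "2 * real (card (all_edges n)) = n * (real n - 1)"
  proof -
    have "even (n * (n - 1))" by (cases n) auto
    then have "2 * card (all_edges n) = n * (n - 1)"
      unfolding card_all_edges choose_two by (rule dvd_mult_div_cancel)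
    then have "2 * real (card (all_edges n)) = real (n * (n - 1))" by linarith
    then show ?thesis using assms by (simp add: of_nat_diff)
  qed
  have "measure_pmf.prob (gnp n p)
      {G. \<not> \<bar>(\<Sum>i<n. real (card (nbhd n G i))) - n * (real n - 1) * p\<bar> \<le> 6 * real n}
    = measure_pmf.prob (gnp n p)
      {G. \<not> \<bar>real (card (G \<inter> all_edges n)) - real (card (all_edges n)) * p\<bar> \<le> 3 * n}"
  proof (rule prob_gnp_cong)
    fix G assume G: "is_graph n G"
    then have "G \<inter> all_edges n = G" by (auto simp: is_graph_def)
    moreover have "(\<Sum>i<n. real (card (nbhd n G i))) = 2 * real (card G)"
      using sum_degrees[OF G] by (metis of_nat_mult of_nat_numeral of_nat_sum)
    ultimately have "(\<Sum>i<n. real (card (nbhd n G i))) - n * (real n - 1) * p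
        = 2 * (real (card (G \<inter> all_edges n)) - real (card (all_edges n)) * p)"
      unfolding N[symmetric] by simp
    then show "(\<not> \<bar>(\<Sum>i<n. real (card (nbhd n G i))) - n * (real n - 1) * p\<bar> \<le> 6 * real n) \<longleftrightarrow>
      (\<not> \<bar>real (card (G \<inter> all_edges n)) - real (card (all_edges n)) * p\<bar> \<le> 3 * n)"
      by (simp only: abs_mult) simp
  qed
  also have "\<dots> \<le> measure_pmf.prob (gnp n p)
      {G. 3 * n \<le> \<bar>real (card (G \<inter> all_edges n)) - real (card (all_edges n)) * p\<bar>}"
    by (intro measure_pmf.finite_measure_mono) auto
  also have "\<dots> \<le> 2 * exp (- 2 * (3 * real n)\<^sup>2 / real (card (all_edges n)))"
    using assms gnp_edges_Hoeffding[of "all_edges n" n p "3 * real n"] by simp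
  \<comment> \<open>There are at most n^2/2 possible edges, so the exponent is at least 18 *
    2.\<close>
  also have "\<dots> \<le> 2 * exp (- 36)"
  proof -
    have "36 * real (card (all_edges n)) \<le> 18 * (real n)\<^sup>2"
      using N by (simp add: algebra_simps power2_eq_square)
    moreover have "0 < real n * (real n - 1)" using assms by simp
    then have "0 < real (card (all_edges n))" using N by linarith
    ultimately show ?thesis by (simp add: field_simps power2_eq_square)
  qed
  \<comment> \<open>This crude bound suffices, since 2/100 + 2/37 is below 1/10.\<close>
  also have "exp (- 36 :: real) \<le> 1 / 37"
    using exp_ge_add_one_self[of "36 :: real"] by (simp add: exp_minus field_simps)
  finally have "1 - 2 / 37 \<le> 1 - measure_pmf.prob (gnp n p)
      {G. \<not> \<bar>(\<Sum>i<n. real (card (nbhd n G i))) - n * (real n - 1) * p\<bar> \<le> 6 * real n}"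
    by simp
  also have "\<dots> = measure_pmf.prob (gnp n p)
      {G. \<bar>(\<Sum>i<n. real (card (nbhd n G i))) - n * (real n - 1) * p\<bar> \<le> 6 * real n}"
    by (subst measure_pmf.prob_compl[symmetric]) (auto intro!: arg_cong[of _ _ "measure_pmf.prob _"])
  finally have "1 - (2 / 100 + 2 / 37) \<le> measure_pmf.prob (gnp n p)
    {G. (\<forall>i\<in>{..<n}. \<bar>real (card (nbhd n G i)) - (real n - 1) * p\<bar> \<le> sqrt (n * ln n)) \<and>
        \<bar>(\<Sum>i<n. real (card (nbhd n G i))) - n * (real n - 1) * p\<bar> \<le> 6 * real n}"
    by (rule prob_conj_ge[OF all])
  then show ?thesis by simp
qed

section \<open>The local randomizers\<close>

definition bit_prob :: "real \<Rightarrow> nat \<Rightarrow> nat \<Rightarrow> nat \<Rightarrow> real" where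
  "bit_prob \<eta> L d k = 1/2 + \<eta> * tent (real d / real L - real k)"

text \<open>A local randomizer outputs a single real number, so its bit vector is packed into a natural
  number.\<close>

definition encode :: "(nat \<Rightarrow> bool) \<Rightarrow> real" where
  "encode f = real (set_encode {k. f k})"

definition decode :: "real \<Rightarrow> nat \<Rightarrow> bool" where
  "decode x k \<longleftrightarrow> k \<in> set_decode (nat \<lfloor>x\<rfloor>)"

definition randomizer :: "nat \<Rightarrow> nat \<Rightarrow> real \<Rightarrow> nat set \<Rightarrow> real pmf" where
  "randomizer K L \<eta> N =
     map_pmf encode (Pi_pmf {..K} False (\<lambda>k. bernoulli_pmf (bit_prob \<eta> L (card N) k)))"

text \<open>A single product over pairs of node and column is the form in which both the privacy and
  the concentration bound are stated.\<close>

definition bits :: "nat \<Rightarrow> nat \<Rightarrow> nat \<Rightarrow> real \<Rightarrow> nat set set \<Rightarrow> (nat \<times> nat \<Rightarrow> bool) pmf" where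
  "bits n K L \<eta> G = Pi_pmf ({..<n} \<times> {..K}) False
     (\<lambda>(i, k). bernoulli_pmf (bit_prob \<eta> L (card (nbhd n G i)) k))"

lemma decode_encode: "finite {k. f k} \<Longrightarrow> decode (encode f) = f"
  by (simp add: decode_def encode_def fun_eq_iff)

lemma rand_outputs_randomizer:
  "rand_outputs n (\<lambda>i. randomizer K L \<eta>) G =
     map_pmf (\<lambda>b i. encode (\<lambda>k. b (i, k))) (bits n K L \<eta> G)"
proof -
  have "rand_outputs n (\<lambda>i. randomizer K L \<eta>) G =
    map_pmf (\<lambda>h. encode \<circ> h) (Pi_pmf {..<n} (\<lambda>_. False) (\<lambda>i. Pi_pmf {..K} False
      (\<lambda>k. bernoulli_pmf (bit_prob \<eta> L (card (nbhd n G i)) k))))"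
    unfolding rand_outputs_def randomizer_def
    by (rule Pi_pmf_map) (auto simp: encode_def)
  also have "\<dots> = map_pmf (\<lambda>b i. encode (\<lambda>k. b (i, k))) (bits n K L \<eta> G)"
    by (simp add: Pi_pmf_Times bits_def pmf.map_comp o_def curry_def)
  finally show ?thesis .
qed

text \<open>Lets the estimator be analysed on the raw bits, although the postprocessing sees only
  the encoded numbers.\<close>

lemma map_decode_rand_outputs:
  "map_pmf (\<lambda>y. F (\<lambda>(i, k). decode (y i) k)) (rand_outputs n (\<lambda>i. randomizer K L \<eta>) G)
   = map_pmf F (bits n K L \<eta> G)"
proof -
  have "map_pmf (\<lambda>y. F (\<lambda>(i, k). decode (y i) k)) (rand_outputs n (\<lambda>i. randomizer K L \<eta>) G)
    = map_pmf (\<lambda>b. F (\<lambda>(i, k). decode (encode (\<lambda>k. b (i, k))) k)) (bits n K L \<eta> G)"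
    by (simp add: rand_outputs_randomizer pmf.map_comp o_def)
  also have "\<dots> = map_pmf F (bits n K L \<eta> G)"
  proof (intro map_pmf_cong refl arg_cong[of _ _ F] ext)
    fix b x assume "b \<in> set_pmf (bits n K L \<eta> G)"
    \<comment> \<open>Off the index set the bits take the default \<open>False\<close>. The set of
      true bits is therefore finite, and \<open>set_encode\<close> can be inverted on it.\<close>
    then have "{k. b (i, k)} \<subseteq> {..K}" for i
      using set_Pi_pmf_subset[of "{..<n} \<times> {..K}" False] by (fastforce simp: bits_def)
    then have "finite {k. b (i, k)}" for i by (rule finite_subset) auto
    then show "(case x of (i, k) \<Rightarrow> decode (encode (\<lambda>k. b (i, k))) k) = b x"
      by (cases x) (simp add: decode_encode)
  qed
  finally show ?thesis .
qed

lemma bit_prob_bounds: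
  assumes "0 \<le> \<eta>" "\<eta> \<le> 1/4"
  shows "bit_prob \<eta> L d k \<in> {1/4..3/4}"
proof -
  have "0 \<le> \<eta> * tent (real d / real L - real k)" using assms tent_nonneg by simp
  moreover have "\<eta> * tent (real d / real L - real k) \<le> 1/4 * 1"
    using assms tent_nonneg tent_le_1 by (intro mult_mono) auto
  ultimately show ?thesis by (simp add: bit_prob_def)
qed

text \<open>In units of \<open>\<eta>\<^sup>2\<close>, the rewired node contributes at most 2 to the
  squared change of the biases and every other node at most 4/L^2. As
  \<open>4 * n \<le> L\<^sup>2\<close>, the total is at most 3, and 192 = 64 * 3.\<close>

lemma indist_rand_outputs:
  assumes G: "is_graph n G" "is_graph n G'" "node_neighbors n G G'"
    and L: "0 < L" "n \<le> K * L" "4 * n \<le> L\<^sup>2"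
    and \<eta>: "0 \<le> \<eta>" "\<eta> \<le> 1/4" "192 * ln (1/\<delta>) * \<eta>\<^sup>2 \<le> \<epsilon>\<^sup>2"
    and \<epsilon>\<delta>: "0 < \<delta>" "\<delta> \<le> 1/2" "0 < \<epsilon>" "\<epsilon> \<le> 1"
  shows "indist \<epsilon> \<delta> (rand_outputs n (\<lambda>i. randomizer K L \<eta>) G)
    (rand_outputs n (\<lambda>i. randomizer K L \<eta>) G')"
proof -
  define x where "x = (\<lambda>H i. real (card (nbhd n H i)) / real L)"
  define D where "D = (\<lambda>i. \<Sum>k\<le>K. (tent (x G i - real k) - tent (x G' i - real k))\<^sup>2)"
  obtain v where v: "v < n"
    "\<And>i. i \<noteq> v \<Longrightarrow> \<bar>real (card (nbhd n G i)) - real (card (nbhd n G' i))\<bar> \<le> 1"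
    using node_neighbors_degrees[OF G(3)] by blast
  have x: "0 \<le> x H i" "x H i < real K" if "i < n" "is_graph n H" for H i
  proof -
    have "card (nbhd n H i) < K * L" using card_nbhd_less that L by fastforce
    then have "real (card (nbhd n H i)) < real K * real L"
      by (metis of_nat_less_iff of_nat_mult)
    then show "x H i < real K" using L by (simp add: x_def field_simps)
  qed (simp add: x_def)
  have "D v \<le> 2" unfolding D_def using x v(1) G by (intro tent_sum_sq_le_2) auto
  have D: "D i \<le> 4 / (real L)\<^sup>2" if "i \<noteq> v" for i
  proof -
    have "D i \<le> 4 * (x G i - x G' i)\<^sup>2"
      unfolding D_def x_def by (intro tent_sum_sq_lipschitz) auto
    also have "x G i - x G' i = (real (card (nbhd n G i)) - real (card (nbhd n G' i))) / real L"
      by (simp add: x_def diff_divide_distrib)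
    also have "4 * \<dots>\<^sup>2 \<le> 4 * (1 / real L)\<^sup>2"
      using v(2)[OF that] L unfolding abs_le_square_iff[symmetric]
      by (intro mult_left_mono) (auto simp: abs_le_square_iff[symmetric] divide_right_mono)
    finally show ?thesis by (simp add: power_divide)
  qed
  have "(\<Sum>i<n. D i) = D v + (\<Sum>i\<in>{..<n} - {v}. D i)"
    using v(1) by (intro sum.remove) auto
  also have "\<dots> \<le> 2 + (\<Sum>i\<in>{..<n} - {v}. 4 / (real L)\<^sup>2)"
    using \<open>D v \<le> 2\<close> D by (intro add_mono sum_mono) auto
  also have "\<dots> \<le> 2 + (\<Sum>i<n. 4 / (real L)\<^sup>2)"
    by (intro add_left_mono sum_mono2) auto
  also have "\<dots> \<le> 3"
  proof -
    have "real (4 * n) \<le> real (L\<^sup>2)" using L(3) of_nat_mono by blast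
    then show ?thesis using L(1) by (simp add: field_simps)
  qed
  finally have sumD: "(\<Sum>i<n. D i) \<le> 3" .

  define q where "q = (\<lambda>H a. bit_prob \<eta> L (card (nbhd n H (fst a))) (snd a))"
  have "(\<Sum>a\<in>{..<n} \<times> {..K}. (q G a - q G' a)\<^sup>2) = (\<Sum>i<n. \<Sum>k\<le>K. (q G (i, k) - q G' (i, k))\<^sup>2)"
    by (subst sum.cartesian_product) (simp add: case_prod_unfold)
  also have "\<dots> = \<eta>\<^sup>2 * (\<Sum>i<n. D i)"
    unfolding D_def sum_distrib_left
    by (intro sum.cong refl) (simp add: q_def bit_prob_def x_def power2_eq_square algebra_simps)
  also have "\<dots> \<le> \<eta>\<^sup>2 * 3" using sumD by (intro mult_left_mono) auto
  finally have "64 * ln (1/\<delta>) * (\<Sum>a\<in>{..<n} \<times> {..K}. (q G a - q G' a)\<^sup>2) \<le> 64 * ln (1/\<delta>) * (\<eta>\<^sup>2 * 3)"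
    using \<epsilon>\<delta> by (intro mult_left_mono) auto
  also have "\<dots> \<le> \<epsilon>\<^sup>2" using \<eta>(3) by simp
  finally have "indist \<epsilon> \<delta> (Pi_pmf ({..<n} \<times> {..K}) False (\<lambda>a. bernoulli_pmf (q G a)))
      (Pi_pmf ({..<n} \<times> {..K}) False (\<lambda>a. bernoulli_pmf (q G' a)))"
    using \<epsilon>\<delta> bit_prob_bounds[OF \<eta>(1,2)] unfolding q_def by (intro indist_Pi_bernoulli) auto
  then have "indist \<epsilon> \<delta> (bits n K L \<eta> G) (bits n K L \<eta> G')"
    by (simp add: q_def bits_def case_prod_unfold)
  then show ?thesis unfolding rand_outputs_randomizer by (rule indist_map_pmf)
qed

section \<open>The estimator\<close>

text \<open>Removing the offset 1/2 and rescaling makes each summand an unbiased estimate of the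
  tent value of node \<open>i\<close> at column \<open>k\<close>.\<close>

definition votes :: "nat \<Rightarrow> real \<Rightarrow> (nat \<times> nat \<Rightarrow> bool) \<Rightarrow> nat \<Rightarrow> real" where
  "votes n \<eta> b k = (\<Sum>i<n. (of_bool (b (i, k)) - 1/2) / \<eta>)"

text \<open>Any column above the threshold will do. With column errors of at most n/16, the
  threshold n/8 is reached wherever the true histogram is at least n/4, and reaching it forces the
  true value to be positive.\<close>

definition heavy :: "nat \<Rightarrow> nat \<Rightarrow> (nat \<Rightarrow> real) \<Rightarrow> nat" where
  "heavy n K V = (SOME k. k \<le> K \<and> real n / 8 \<le> V k)"

text \<open>In units of cells, the sum of the degrees: the moment is centred at the heavy column, so that
  only the noise of five columns enters, with bounded weights.\<close>

definition total :: "nat \<Rightarrow> nat \<Rightarrow> (nat \<Rightarrow> real) \<Rightarrow> real" where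
  "total n K V = (\<Sum>k | k \<le> K \<and> \<bar>real k - real (heavy n K V)\<bar> \<le> 2. (real k - real (heavy n K V)) * V k)
     + real n * real (heavy n K V)"

text \<open>The factor \<open>real L\<close> converts cells back into degrees; the degrees sum to
  n(n-1)p in expectation.\<close>

definition estimate :: "nat \<Rightarrow> nat \<Rightarrow> nat \<Rightarrow> real \<Rightarrow> (nat \<times> nat \<Rightarrow> bool) \<Rightarrow> real" where
  "estimate n K L \<eta> b = real L * total n K (votes n \<eta> b) / (real n * (real n - 1))"

text \<open>The deterministic part of the accuracy proof. The coarse bound on all columns only
  locates the heavy one. The fine bound is required on a window around \<open>\<mu>\<close>, which
  is fixed independently of the noise, and the window around the heavy column lies inside it: 13/4 =
  5/4 + 2.\<close>

lemma total_close:
  fixes x :: "nat \<Rightarrow> real" and V :: "nat \<Rightarrow> real"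
  assumes "0 < n"
    and x: "\<And>i. i < n \<Longrightarrow> 0 \<le> x i" "\<And>i. i < n \<Longrightarrow> x i < real K" "\<And>i. i < n \<Longrightarrow> \<bar>x i - \<mu>\<bar> \<le> 1/4"
    and \<mu>: "0 \<le> \<mu>" "\<mu> < real K"
  defines "H \<equiv> \<lambda>k. \<Sum>i<n. tent (x i - real k)"
  assumes coarse: "\<And>k. k \<le> K \<Longrightarrow> \<bar>V k - H k\<bar> \<le> real n / 16"
    and fine: "\<And>k. k \<le> K \<Longrightarrow> \<bar>real k - \<mu>\<bar> \<le> 13/4 \<Longrightarrow> \<bar>V k - H k\<bar> \<le> s"
  shows "\<bar>total n K V - (\<Sum>i<n. x i)\<bar> \<le> 10 * s"
proof -
  define h where "h = heavy n K V"
  have "\<exists>k. k \<le> K \<and> real n / 8 \<le> V k"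
  proof (intro exI conjI)
    \<comment> \<open>The column nearest to \<open>\<mu>\<close> is within 1/2 + 1/4 of every
      \<open>x i\<close>, so each node gives it weight at least 1/4.\<close>
    let ?k = "nat \<lfloor>\<mu> + 1/2\<rfloor>"
    show "?k \<le> K" using \<mu> by linarith
    have k: "\<bar>\<mu> - real ?k\<bar> \<le> 1/2" using \<mu> by linarith
    have "(\<Sum>i<n. 1/4) \<le> H ?k"
      unfolding H_def
    proof (intro sum_mono)
      fix i assume "i \<in> {..<n}"
      then have "\<bar>x i - real ?k\<bar> \<le> 3/4" using x(3)[of i] k unfolding lessThan_iff by linarith
      then show "1/4 \<le> tent (x i - real ?k)" using tent_ge[of "x i - real ?k"] by linarith
    qed
    then have "real n / 4 \<le> H ?k" by simp
    then show "real n / 8 \<le> V ?k"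
      using coarse[OF \<open>?k \<le> K\<close>] unfolding abs_le_iff by linarith
  qed
  then have "h \<le> K \<and> real n / 8 \<le> V h"
    unfolding h_def heavy_def by (rule someI_ex)
  then have "real n / 8 \<le> V h" "\<bar>V h - H h\<bar> \<le> real n / 16" "0 < real n"
    using coarse[of h] \<open>0 < n\<close> by auto
  then have "0 < H h" by linarith
  \<comment> \<open>A positive column has some \<open>x i\<close> at distance below 1, and
    \<open>x i\<close> is within 1/4 of \<open>\<mu>\<close>; hence the 5/4.\<close>
  then obtain i where i: "i < n" "0 < tent (x i - real h)"
    unfolding H_def by (metis lessThan_iff linorder_not_le sum_nonpos)
  then have h\<mu>: "\<bar>real h - \<mu>\<bar> < 5/4" using x(3)[of i] tent_pos_imp[of "x i - real h"] by linarith
  define W where "W = {k. k \<le> K \<and> \<bar>real k - real h\<bar> \<le> 2}"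
  have "W \<subseteq> {h - 2..h + 2}" by (auto simp: W_def)
  then have card_W: "card W \<le> 5" using card_mono[of "{h - 2..h + 2}" W] by simp
  have moment: "(\<Sum>k\<in>W. (real k - real h) * tent (x i - real k)) = x i - real h" if "i < n" for i
  proof -
    have "\<bar>x i - real h\<bar> < 3/2" using x(3)[OF that] h\<mu> by linarith
    have "tent (x i - real k) = 0" if "k \<notin> W" "k \<le> K" for k
    proof (rule tent_eq_0)
      \<comment> \<open>Columns are integers, so a distance above 2 is at least 3. This exceeds the
        distance 3/2 from \<open>h\<close> to \<open>x i\<close> by more than the unit radius of a
        tent, so dropping these columns is exact.\<close>
      have "3 \<le> \<bar>real k - real h\<bar>" 
      proof (rule ccontr)
        assume "\<not> 3 \<le> \<bar>real k - real h\<bar>"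
        then have "k \<le> h + 2" "h \<le> k + 2" by linarith+
        then have "\<bar>real k - real h\<bar> \<le> 2" by linarith
        then show False using that by (simp add: W_def)
      qed
      then show "1 \<le> \<bar>x i - real k\<bar>" using \<open>\<bar>x i - real h\<bar> < 3/2\<close> by linarith
    qed
    then have "(\<Sum>k\<in>W. (real k - real h) * tent (x i - real k))
        = (\<Sum>k\<le>K. (real k - real h) * tent (x i - real k))"
      by (intro sum.mono_neutral_left) (auto simp: W_def)
    then show ?thesis using tent_sum_moment[of "x i" K "real h"] x that by simp
  qed
  have "(\<Sum>k\<in>W. (real k - real h) * H k) = (\<Sum>i<n. \<Sum>k\<in>W. (real k - real h) * tent (x i - real k))"
    unfolding H_def sum_distrib_left by (rule sum.swap)
  also have "\<dots> = (\<Sum>i<n. x i) - real n * real h"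
    using moment by (simp add: sum_subtractf)
  \<comment> \<open>The recentring term \<open>real n * real h\<close> cancels, leaving only the
    noise of at most five columns with weights of absolute value at most 2.\<close>
  finally have total_diff: "total n K V - (\<Sum>i<n. x i) = (\<Sum>k\<in>W. (real k - real h) * (V k - H k))"
    unfolding total_def h_def[symmetric] W_def[symmetric]
    by (simp add: algebra_simps sum_subtractf sum.distrib)
  have close: "\<bar>V k - H k\<bar> \<le> s" if "k \<in> W" for k
  proof (rule fine)
    have "\<bar>real k - real h\<bar> \<le> 2" using that by (simp add: W_def)
    then show "\<bar>real k - \<mu>\<bar> \<le> 13/4" using h\<mu> by linarith
  qed (use that in \<open>simp add: W_def\<close>)
  have "\<bar>total n K V - (\<Sum>i<n. x i)\<bar> \<le> (\<Sum>k\<in>W. \<bar>(real k - real h) * (V k - H k)\<bar>)"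
    unfolding total_diff by (rule sum_abs)
  also have "\<dots> \<le> (\<Sum>k\<in>W. 2 * s)"
    unfolding abs_mult using close by (intro sum_mono mult_mono) (auto simp: W_def)
  also have "\<dots> = real (card W) * (2 * s)" by simp
  also have "\<dots> \<le> 5 * (2 * s)"
  proof (intro mult_right_mono)
    \<comment> \<open>The sign of \<open>s\<close> is read off from the bound at the heavy column
      itself.\<close>
    have "\<bar>V h - H h\<bar> \<le> s" using \<open>h \<le> K \<and> _\<close> by (intro close) (simp add: W_def)
    then show "0 \<le> 2 * s" by simp
  qed (use card_W in simp)
  finally show ?thesis by simp
qed

text \<open>Scaled by \<open>\<eta>\<close>, the error of a column is a sum of \<open>n\<close>
  independent centred bits.\<close>

lemma votes_Hoeffding:
  assumes "k \<le> K" "0 < n" "0 < \<eta>" "\<eta> \<le> 1/4" "0 \<le> t"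
  shows "measure_pmf.prob (bits n K L \<eta> G)
      {b. \<not> \<bar>votes n \<eta> b k - (\<Sum>i<n. tent (card (nbhd n G i) / L - k))\<bar> \<le> t}
    \<le> 2 * exp (- 2 * (\<eta> * t)\<^sup>2 / n)"
proof -
  let ?q = "\<lambda>a. bit_prob \<eta> L (card (nbhd n G (fst a))) (snd a)"
  let ?B = "(\<lambda>i. (i, k)) ` {..<n}"
  have eq: "\<eta> * (votes n \<eta> b k - (\<Sum>i<n. tent (card (nbhd n G i) / L - k)))
      = (\<Sum>a\<in>?B. of_bool (b a) - ?q a)" for b
    unfolding votes_def sum_subtractf[symmetric] sum_distrib_left using assms
    by (subst sum.reindex) (auto simp: inj_on_def bit_prob_def field_simps intro!: sum.cong)
  have "measure_pmf.prob (bits n K L \<eta> G)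
      {b. \<not> \<bar>votes n \<eta> b k - (\<Sum>i<n. tent (card (nbhd n G i) / L - k))\<bar> \<le> t}
    \<le> measure_pmf.prob (bits n K L \<eta> G) {b. \<eta> * t \<le> \<bar>\<Sum>a\<in>?B. of_bool (b a) - ?q a\<bar>}"
    unfolding eq[symmetric] abs_mult using assms
    by (intro measure_pmf.finite_measure_mono) auto
  also have "\<dots> \<le> 2 * exp (- 2 * (\<eta> * t)\<^sup>2 / real (card ?B))"
    unfolding bits_def case_prod_unfold using assms bit_prob_bounds[of \<eta> L]
    by (intro Pi_bernoulli_Hoeffding) (auto intro: order.trans[of _ "3/4"] order.trans[of _ "1/4"])
  also have "card ?B = n" by (simp add: card_image inj_on_def)
  finally show ?thesis .
qed

text \<open>All columns must meet the coarse bound, which costs a union bound over at most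
  \<open>n\<close> of them. Only boundedly many must meet the fine bound, so \<open>s\<close>
  carries no logarithm. The error splits into \<open>6 * n\<close> from sampling the graph and
  \<open>10 * L * s\<close> from the bits.\<close>

lemma bits_accurate:
  assumes n: "100 \<le> n" and L: "0 < L" "n \<le> K * L" "K < n"
    and \<eta>: "0 < \<eta>" "\<eta> \<le> 1/4" "256 * ln n \<le> \<eta>\<^sup>2 * n"
    and p: "0 \<le> p" "p \<le> 1"
    and G: "is_graph n G" "\<And>i. i < n \<Longrightarrow> \<bar>real (card (nbhd n G i)) - (real n - 1) * p\<bar> \<le> L / 4"
      "\<bar>(\<Sum>i<n. real (card (nbhd n G i))) - n * (real n - 1) * p\<bar> \<le> 6 * real n"
  shows "9/10 \<le> measure_pmf.prob (bits n K L \<eta> G)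
    {b. \<bar>estimate n K L \<eta> b - p\<bar> \<le> (6 * real n + 10 * real L * (13 * sqrt n / \<eta>)) / (real n * (real n - 1))}"
proof -
  define x where "x = (\<lambda>i. real (card (nbhd n G i)) / real L)"
  define \<mu> where "\<mu> = (real n - 1) * p / real L"
  define H where "H = (\<lambda>k. \<Sum>i<n. tent (x i - real k))"
  \<comment> \<open>This choice makes the Hoeffding exponent 2 * 13^2 = 338, whatever
    \<open>n\<close> and \<open>\<eta>\<close> are.\<close>
  define s where "s = 13 * sqrt n / \<eta>"
  have KL: "real n \<le> real K * real L" using L by (metis of_nat_le_iff of_nat_mult)
  have x: "0 \<le> x i" "x i < real K" "\<bar>x i - \<mu>\<bar> \<le> 1/4" if "i < n" for i
  proof -
    have "real (card (nbhd n G i)) < real n" using card_nbhd_less[OF G(1) that] by simp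
    then show "x i < real K" using L KL by (simp add: x_def field_simps)
    have "x i - \<mu> = (real (card (nbhd n G i)) - (real n - 1) * p) / real L"
      by (simp add: x_def \<mu>_def diff_divide_distrib)
    then show "\<bar>x i - \<mu>\<bar> \<le> 1/4" using G(2)[OF that] L by (simp add: abs_divide divide_le_eq)
  qed (simp add: x_def)
  have \<mu>: "0 \<le> \<mu>" "\<mu> < real K"
  proof -
    have "(real n - 1) * p \<le> (real n - 1) * 1" using p n by (intro mult_left_mono) auto
    also have "\<dots> < real K * real L" using KL by simp
    finally have "(real n - 1) * p < real K * real L" .
    then show "\<mu> < real K" using L by (simp add: \<mu>_def field_simps)
  qed (use p n in \<open>simp add: \<mu>_def\<close>)

  have "1 - (\<Sum>k\<in>{..K}. 2 / (real n)\<^sup>2)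
      \<le> measure_pmf.prob (bits n K L \<eta> G) {b. \<forall>k\<in>{..K}. \<bar>votes n \<eta> b k - H k\<bar> \<le> real n / 16}"
  proof (rule prob_Ball_ge)
    fix k assume "k \<in> {..K}"
    then have "measure_pmf.prob (bits n K L \<eta> G) {b. \<not> \<bar>votes n \<eta> b k - H k\<bar> \<le> real n / 16}
      \<le> 2 * exp (- 2 * (\<eta> * (real n / 16))\<^sup>2 / n)"
      unfolding H_def x_def using n \<eta> by (intro votes_Hoeffding) auto
    also have "- 2 * (\<eta> * (real n / 16))\<^sup>2 / n = - (\<eta>\<^sup>2 * n / 128)"
      using n by (simp add: power2_eq_square)
    \<comment> \<open>The hypothesis \<open>256 * ln n \<le> \<eta>\<^sup>2 * n\<close> is exactly
      what gives failure probability 2/n^2 per column.\<close>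
    also have "2 * exp \<dots> \<le> 2 * exp (- (2 * ln n))"
      using \<eta>(3) by simp
    also have "\<dots> = 2 / (real n)\<^sup>2"
      using n by (simp add: exp_minus exp_double divide_inverse)
    finally show "measure_pmf.prob (bits n K L \<eta> G) {b. \<not> \<bar>votes n \<eta> b k - H k\<bar> \<le> real n / 16}
      \<le> 2 / (real n)\<^sup>2" .
  qed auto
  moreover have "(\<Sum>k\<in>{..K}. 2 / (real n)\<^sup>2) \<le> 2 / 100"
  proof -
    have "(\<Sum>k\<in>{..K}. 2 / (real n)\<^sup>2) = real (K + 1) * (2 / (real n)\<^sup>2)" by simp
    also have "\<dots> \<le> real n * (2 / (real n)\<^sup>2)" using L(3) by (intro mult_right_mono) auto
    also have "\<dots> = 2 / n" using n by (simp add: power2_eq_square)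
    also have "\<dots> \<le> 2 / 100" using n by (intro divide_left_mono) auto
    finally show ?thesis .
  qed
  ultimately have coarse: "1 - 2 / 100 \<le> measure_pmf.prob (bits n K L \<eta> G)
      {b. \<forall>k\<in>{..K}. \<bar>votes n \<eta> b k - H k\<bar> \<le> real n / 16}"
    by linarith

  define J where "J = {k. k \<le> K \<and> \<bar>real k - \<mu>\<bar> \<le> 13/4}"
  have "J \<subseteq> {nat \<lfloor>\<mu>\<rfloor> - 3..nat \<lfloor>\<mu>\<rfloor> + 4}"
  proof
    fix k assume "k \<in> J"
    then have "\<bar>real k - \<mu>\<bar> \<le> 13/4" by (simp add: J_def)
    \<comment> \<open>As 13/4 is not an integer multiple of the grid, the bounds are rounded to
      integers: 3 columns below the floor, the floor itself, and 4 above.\<close>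
    then have "int k \<le> \<lfloor>\<mu>\<rfloor> + 4" "\<lfloor>\<mu>\<rfloor> \<le> int k + 3" by linarith+
    then show "k \<in> {nat \<lfloor>\<mu>\<rfloor> - 3..nat \<lfloor>\<mu>\<rfloor> + 4}" by auto
  qed
  then have "card J \<le> card {nat \<lfloor>\<mu>\<rfloor> - 3..nat \<lfloor>\<mu>\<rfloor> + 4}" by (intro card_mono) auto
  then have card_J: "card J \<le> 8" by simp
  have "1 - (\<Sum>k\<in>J. 2 / 339)
      \<le> measure_pmf.prob (bits n K L \<eta> G) {b. \<forall>k\<in>J. \<bar>votes n \<eta> b k - H k\<bar> \<le> s}"
  proof (rule prob_Ball_ge)
    fix k assume "k \<in> J"
    then have "measure_pmf.prob (bits n K L \<eta> G) {b. \<not> \<bar>votes n \<eta> b k - H k\<bar> \<le> s}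
      \<le> 2 * exp (- 2 * (\<eta> * s)\<^sup>2 / n)"
      unfolding H_def x_def using n \<eta> by (intro votes_Hoeffding) (auto simp: s_def J_def)
    also have "- 2 * (\<eta> * s)\<^sup>2 / n = - 338"
      using n \<eta> by (simp add: s_def power_mult_distrib)
    also have "exp (- 338 :: real) \<le> 1 / 339"
      using exp_ge_add_one_self[of "338 :: real"] by (simp add: exp_minus field_simps)
    finally show "measure_pmf.prob (bits n K L \<eta> G) {b. \<not> \<bar>votes n \<eta> b k - H k\<bar> \<le> s} \<le> 2 / 339"
      by simp
  qed (simp add: J_def)
  moreover have "(\<Sum>k\<in>J. 2 / 339) \<le> (16 / 339 :: real)" using card_J by simp
  ultimately have "1 - 16 / 339 \<le> measure_pmf.prob (bits n K L \<eta> G)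
      {b. \<forall>k\<in>J. \<bar>votes n \<eta> b k - H k\<bar> \<le> s}"
    by linarith
  from prob_conj_ge[OF coarse this]
  have "9/10 \<le> measure_pmf.prob (bits n K L \<eta> G)
      {b. (\<forall>k\<in>{..K}. \<bar>votes n \<eta> b k - H k\<bar> \<le> real n / 16) \<and> (\<forall>k\<in>J. \<bar>votes n \<eta> b k - H k\<bar> \<le> s)}"
    by simp
  also have "\<dots> \<le> measure_pmf.prob (bits n K L \<eta> G)
    {b. \<bar>estimate n K L \<eta> b - p\<bar> \<le> (6 * real n + 10 * real L * s) / (real n * (real n - 1))}"
  proof (intro measure_pmf.finite_measure_mono subsetI CollectI)
    fix b assume "b \<in> {b. (\<forall>k\<in>{..K}. \<bar>votes n \<eta> b k - H k\<bar> \<le> real n / 16)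
      \<and> (\<forall>k\<in>J. \<bar>votes n \<eta> b k - H k\<bar> \<le> s)}"
    then have "\<bar>total n K (votes n \<eta> b) - (\<Sum>i<n. x i)\<bar> \<le> 10 * s"
      using n x \<mu> by (intro total_close[where \<mu> = \<mu>]) (auto simp: H_def J_def)
    then have "real L * \<bar>total n K (votes n \<eta> b) - (\<Sum>i<n. x i)\<bar> \<le> real L * (10 * s)"
      by (intro mult_left_mono) auto
    moreover have "real L * (\<Sum>i<n. x i) = (\<Sum>i<n. real (card (nbhd n G i)))"
      using L by (simp add: x_def sum_distrib_left)
    then have "real L * total n K (votes n \<eta> b) - (\<Sum>i<n. real (card (nbhd n G i)))
        = real L * (total n K (votes n \<eta> b) - (\<Sum>i<n. x i))"
      by (simp add: right_diff_distrib)
    ultimately have "\<bar>real L * total n K (votes n \<eta> b) - (\<Sum>i<n. real (card (nbhd n G i)))\<bar>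
        \<le> 10 * real L * s"
      by (simp add: abs_mult)
    then have *: "\<bar>real L * total n K (votes n \<eta> b) - n * (real n - 1) * p\<bar> \<le> 6 * real n + 10 * real L * s"
      using G(3) by linarith
    have pos: "0 < real n * (real n - 1)" using n by simp
    then have "estimate n K L \<eta> b - p
        = (real L * total n K (votes n \<eta> b) - n * (real n - 1) * p) / (real n * (real n - 1))"
      using n by (simp add: estimate_def diff_divide_distrib)
    then have "\<bar>estimate n K L \<eta> b - p\<bar>
        = \<bar>real L * total n K (votes n \<eta> b) - n * (real n - 1) * p\<bar> / (real n * (real n - 1))"
      using pos by (simp add: abs_divide)
    also have "\<dots> \<le> (6 * real n + 10 * real L * s) / (real n * (real n - 1))"
      using * pos by (intro divide_right_mono) auto
    finally show "\<bar>estimate n K L \<eta> b - p\<bar> \<le> (6 * real n + 10 * real L * s) / (real n * (real n - 1))" .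
  qed auto
  finally show ?thesis by (simp add: s_def)
qed

section \<open>Choice of the parameters and assembly of privacy and accuracy\<close>

theorem theorem4p8:
  shows "\<exists>(c::real) (C::real) (n0::nat). c > 0 \<and> C > 0 \<and>
    (\<forall>n \<ge> n0. \<forall>\<delta> \<epsilon> :: real.
       0 < \<delta> \<and> \<delta> \<le> 1/2 \<and> 0 < \<epsilon> \<and> \<epsilon> \<le> 1 \<and>
       \<epsilon> \<ge> c * sqrt (ln (real n) * ln (1/\<delta>) / real n) \<longrightarrow>
       (\<exists>A. LNDP n \<epsilon> \<delta> A \<and>
          (\<forall>p::real. 0 \<le> p \<and> p \<le> 1 \<longrightarrow>
             measure_pmf.prob (bind_pmf (gnp n p) A)
               {x. \<bar>x - p\<bar> \<le> C * (sqrt (ln (real n)) / real n) * (sqrt (ln (1/\<delta>)) / \<epsilon>)}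
             \<ge> 2/3)))"
proof (rule exI[of _ 224], rule exI[of _ 20000], rule exI[of _ 100], intro conjI allI impI)
  fix n :: nat and \<delta> \<epsilon> :: real
  assume n: "100 \<le> n"
  assume "0 < \<delta> \<and> \<delta> \<le> 1/2 \<and> 0 < \<epsilon> \<and> \<epsilon> \<le> 1 \<and>
       \<epsilon> \<ge> 224 * sqrt (ln (real n) * ln (1/\<delta>) / real n)"
  then have \<epsilon>\<delta>: "0 < \<delta>" "\<delta> \<le> 1/2" "0 < \<epsilon>" "\<epsilon> \<le> 1"
    and \<epsilon>: "224 * sqrt (ln (real n) * ln (1/\<delta>) / real n) \<le> \<epsilon>" by auto
  define l where "l = ln (1/\<delta>)"
  \<comment> \<open>The 14 satisfies 14^2 = 196 \<ge> 192, as the privacy bound demands.\<close>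
  define \<eta> where "\<eta> = \<epsilon> / (14 * sqrt l)"
  define w where "w = sqrt (real n * ln (real n))"
  \<comment> \<open>Four times the degree deviation \<open>w\<close>, so that all degrees lie within
    a quarter of a cell around their mean.\<close>
  define L where "L = nat \<lceil>4 * w\<rceil>"
  \<comment> \<open>The extra 1 makes \<open>K * L\<close> exceed \<open>n\<close>, so every degree
    lies below the last boundary.\<close>
  define K where "K = n div L + 1"
  define A where "A = (\<lambda>G. map_pmf (estimate n K L \<eta>) (bits n K L \<eta> G))"
  have l: "1/2 \<le> l" unfolding l_def using \<epsilon>\<delta>(1,2) by (rule half_le_ln_inverse)
  have sqrt_l: "1/2 \<le> sqrt l" using l by (intro real_le_rsqrt) (simp add: power2_eq_square)
  have ln_n: "1 \<le> ln (real n)"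
    using n exp_le by (subst ln_ge_iff) auto
  have w2: "w\<^sup>2 = real n * ln (real n)" using ln_n by (simp add: w_def)
  have "1 * 1 \<le> real n * ln (real n)" using n ln_n by (intro mult_mono) auto
  then have w: "1 \<le> w" unfolding w_def by simp
  have L: "4 * w \<le> real L" "real L \<le> 5 * w"
    using w unfolding L_def by linarith+
  then have "4 \<le> L" using w by linarith
  have nKL: "n \<le> K * L"
    using dividend_less_times_div[of L n] \<open>4 \<le> L\<close> by (simp add: K_def algebra_simps)
  have "n div L \<le> n div 4" using \<open>4 \<le> L\<close> by (intro div_le_mono2) auto
  then have Kn: "K < n" using n unfolding K_def by linarith
  have "real (4 * n) \<le> (4 * w)\<^sup>2"
    using n ln_n by (simp add: power_mult_distrib w2)
  also have "\<dots> \<le> (real L)\<^sup>2" using L w by (intro power_mono) auto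
  finally have L2: "4 * n \<le> L\<^sup>2" by (metis of_nat_le_iff of_nat_power)
  have \<eta>: "0 < \<eta>" "\<eta> \<le> 1/4"
    using \<epsilon>\<delta> l sqrt_l by (auto simp: \<eta>_def field_simps)
  have \<eta>2: "\<eta>\<^sup>2 = \<epsilon>\<^sup>2 / (196 * l)"
    using l by (simp add: \<eta>_def power_divide power_mult_distrib)
  have privacy_budget: "192 * ln (1/\<delta>) * \<eta>\<^sup>2 \<le> \<epsilon>\<^sup>2"
    using l unfolding \<eta>2 l_def[symmetric] by (simp add: field_simps)
  \<comment> \<open>The constant is 224 = 14 * 16: its square is 196 * 256, which turns the lower
    bound on \<open>\<epsilon>\<close> into the signal condition on \<open>\<eta>\<close>.\<close>
  have "(224 * sqrt (ln (real n) * l / real n))\<^sup>2 \<le> \<epsilon>\<^sup>2"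
    using \<epsilon> l ln_n unfolding l_def[symmetric] by (intro power_mono) auto
  then have "50176 * (ln (real n) * l / real n) \<le> \<epsilon>\<^sup>2"
    using l ln_n by (simp add: power_mult_distrib)
  then have signal: "256 * ln n \<le> \<eta>\<^sup>2 * n"
    using l n unfolding \<eta>2 by (simp add: field_simps)

  have "LNDP n \<epsilon> \<delta> A"
    unfolding LNDP_def
  proof (intro exI conjI allI impI)
    show "A G = bind_pmf (return_pmf (0::nat)) (\<lambda>\<rho>.
        map_pmf (\<lambda>y. estimate n K L \<eta> (\<lambda>(i, k). decode (y i) k))
          (rand_outputs n ((\<lambda>_ _. randomizer K L \<eta>) \<rho>) G))" for G
      by (simp add: A_def bind_return_pmf map_decode_rand_outputs)
    show "indist \<epsilon> \<delta> (rand_outputs n ((\<lambda>_ _. randomizer K L \<eta>) \<rho>) G)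
        (rand_outputs n ((\<lambda>_ _. randomizer K L \<eta>) \<rho>) G')"
      if "is_graph n G \<and> is_graph n G' \<and> node_neighbors n G G'" for \<rho> :: nat and G G'
      using that \<epsilon>\<delta> \<eta> \<open>4 \<le> L\<close> nKL L2 privacy_budget by (intro indist_rand_outputs) auto
  qed
  moreover have "2/3 \<le> measure_pmf.prob (bind_pmf (gnp n p) A)
      {x. \<bar>x - p\<bar> \<le> 20000 * (sqrt (ln (real n)) / real n) * (sqrt (ln (1/\<delta>)) / \<epsilon>)}"
    if p: "0 \<le> p \<and> p \<le> 1" for p
  proof -
    define u where "u = sqrt (ln (real n)) * sqrt l / \<epsilon>"
    define err where "err = (6 * real n + 10 * real L * (13 * sqrt n / \<eta>)) / (real n * (real n - 1))"
    \<comment> \<open>A lower bound on \<open>u\<close> lets the sampling error \<open>6 * n\<close>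
      be absorbed into the privacy error.\<close>
    have "1 * (1/2) / 1 \<le> u"
      unfolding u_def using ln_n l sqrt_l \<epsilon>\<delta> by (intro frac_le mult_mono mult_nonneg_nonneg) auto
    then have "real n * 6 \<le> real n * (12 * u)" by (intro mult_left_mono) auto
    moreover have "10 * real L * (13 * sqrt n / \<eta>) \<le> real n * (9100 * u)"
    proof -
      have "10 * real L * (13 * sqrt n / \<eta>) \<le> 10 * (5 * w) * (13 * sqrt n / \<eta>)"
        using L \<eta> by (intro mult_right_mono mult_left_mono) auto
      \<comment> \<open>Here 650 = 10 * 5 * 13; the 14 in \<open>\<eta>\<close> turns it into 9100.
        With the 12 from sampling this stays below 10000, and replacing \<open>n - 1\<close> by
        \<open>n / 2\<close> doubles that.\<close>
      also have "\<dots> = 650 * (sqrt n * sqrt n) * sqrt (ln n) / \<eta>"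
        by (simp add: w_def real_sqrt_mult)
      also have "\<dots> = real n * (9100 * u)"
        by (simp add: \<eta>_def u_def)
      finally show ?thesis .
    qed
    moreover have "0 \<le> real n * u" using \<open>1 * (1/2) / 1 \<le> u\<close> by simp
    ultimately have "6 * real n + 10 * real L * (13 * sqrt n / \<eta>) \<le> real n * (10000 * u)"
      by (simp only: mult.left_commute[of _ _ u] mult.commute[of "real n"])
    then have "err \<le> real n * (10000 * u) / (real n * (real n - 1))"
      unfolding err_def using n by (intro divide_right_mono) auto
    also have "\<dots> = 10000 * u / (real n - 1)" using n by simp
    also have "\<dots> \<le> 10000 * u / (real n / 2)"
      using n \<open>1 * (1/2) / 1 \<le> u\<close> by (intro divide_left_mono) auto
    finally have err: "err \<le> 20000 * (sqrt (ln (real n)) / real n) * (sqrt (ln (1/\<delta>)) / \<epsilon>)"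
      by (simp add: u_def l_def mult_ac)
    \<comment> \<open>One factor is for the random graph, the other for the bits given the
      graph.\<close>
    have "(2/3::real) \<le> 9/10 * (9/10)" by simp
    also have "\<dots> \<le> measure_pmf.prob (bind_pmf (gnp n p) A)
      {x. \<bar>x - p\<bar> \<le> 20000 * (sqrt (ln (real n)) / real n) * (sqrt (ln (1/\<delta>)) / \<epsilon>)}"
    proof (rule prob_bind_pmf_ge)
      show "9/10 \<le> measure_pmf.prob (gnp n p)
        {G. (\<forall>i\<in>{..<n}. \<bar>real (card (nbhd n G i)) - (real n - 1) * p\<bar> \<le> sqrt (n * ln n)) \<and>
          \<bar>(\<Sum>i<n. real (card (nbhd n G i))) - n * (real n - 1) * p\<bar> \<le> 6 * real n}"
        using n p by (intro gnp_degrees_concentrated) auto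
    next
      fix G
      assume "G \<in> set_pmf (gnp n p)"
        and "G \<in> {G. (\<forall>i\<in>{..<n}. \<bar>real (card (nbhd n G i)) - (real n - 1) * p\<bar> \<le> sqrt (n * ln n)) \<and>
          \<bar>(\<Sum>i<n. real (card (nbhd n G i))) - n * (real n - 1) * p\<bar> \<le> 6 * real n}"
      then have G: "is_graph n G"
        "\<And>i. i < n \<Longrightarrow> \<bar>real (card (nbhd n G i)) - (real n - 1) * p\<bar> \<le> w"
        "\<bar>(\<Sum>i<n. real (card (nbhd n G i))) - n * (real n - 1) * p\<bar> \<le> 6 * real n"
        using is_graph_gnp by (auto simp: w_def)
      have deg: "\<bar>real (card (nbhd n G i)) - (real n - 1) * p\<bar> \<le> L / 4" if "i < n" for i
        using G(2)[OF that] L(1) by linarith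
      have "9/10 \<le> measure_pmf.prob (bits n K L \<eta> G) {b. \<bar>estimate n K L \<eta> b - p\<bar> \<le> err}"
        unfolding err_def using n p \<open>4 \<le> L\<close> nKL Kn \<eta> signal G deg by (intro bits_accurate) auto
      also have "\<dots> \<le> measure_pmf.prob (bits n K L \<eta> G) {b. \<bar>estimate n K L \<eta> b - p\<bar> \<le>
          20000 * (sqrt (ln (real n)) / real n) * (sqrt (ln (1/\<delta>)) / \<epsilon>)}"
        using err by (intro measure_pmf.finite_measure_mono) auto
      finally show "9/10 \<le> measure_pmf.prob (A G)
        {x. \<bar>x - p\<bar> \<le> 20000 * (sqrt (ln (real n)) / real n) * (sqrt (ln (1/\<delta>)) / \<epsilon>)}"
        by (simp add: A_def vimage_def)
    qed simp
    finally show ?thesis .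
  qed
  ultimately show "\<exists>A. LNDP n \<epsilon> \<delta> A \<and>
      (\<forall>p::real. 0 \<le> p \<and> p \<le> 1 \<longrightarrow>
         measure_pmf.prob (bind_pmf (gnp n p) A)
           {x. \<bar>x - p\<bar> \<le> 20000 * (sqrt (ln (real n)) / real n) * (sqrt (ln (1/\<delta>)) / \<epsilon>)}
         \<ge> 2/3)"
    by blast
qed simp_all

end
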